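(* Let $\mathfrak A$ be a Boolean algebra of sets with $|\mathfrak A|=\kappa$. Suppose that $\mathfrak A$ has $\mathrm{LEP}(r)$ for some $r>1$ and that its Stone space $\mathrm{ult}(\mathfrak A)$ is separable. Then, assuming Martin's axiom for $\kappa$, $\mathrm{MA}(\kappa)$, the algebra $\mathfrak A$ has the approximation property.
   Context: Let $\mathfrak A$ be an algebra of subsets of a set $X$. $M(\mathfrak A)$ is the space of signed finitely additive functions $\mathfrak A\to\mathbb R$ of bounded variation, with $\|\mu\|=|\mu|(X)$, $|\mu|$ being the variation of $\mu$; $M_r(\mathfrak A)=\{\mu\in M(\mathfrak A):\|\mu\|\le r\}$. For a finite subalgebra $\mathfrak B\subseteq\mathfrak A$, $M_r^{\mathbb Q}(\mathfrak B)$ is the set of rational-valued $\mu\in M(\mathfrak B)$ with $\|\mu\|\le r$. For real-valued functions $\varphi,\psi$ defined at least on $\mathfrak B$, $\mathrm{dist}_{\mathfrak B}(\varphi,\psi)=\sup_{B\in\mathfrak B}|\varphi(B)-\psi(B)|$. $\langle\mathcal F\rangle$ is the subalgebra generated by $\mathcal F$. Approximation property of $\mathfrak A$: for any sequence of arbitrary functions $\varphi_n:\mathfrak A\to[-1,1]$ such that $\inf_{\mu\in M_1(\mathfrak A)}\mathrm{dist}_{\mathfrak B}(\mu,\varphi_n)\to0$ for every finite subalgebra $\mathfrak B\subseteq\mathfrak A$, there is a bounded sequence $(\nu_n)$ in $M(\mathfrak A)$ with $\varphi_n(a)-\nu_n(a)\to0$ for all $a\in\mathfrak A$. $\mathrm{LEP}(r)$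 (local extension property), $r>1$: there is a family $\mathbb B$ of finite subalgebras of $\mathfrak A$ such that (i) every finite subalgebra $\mathfrak C\subseteq\mathfrak A$ is contained in some $\mathfrak B\in\mathbb B$; (ii) whenever $\mathbb B'\subseteq\mathbb B$ is uncountable, there are distinct $\mathfrak B_1,\mathfrak B_2\in\mathbb B'$ such that any pair of consistent measures $\nu_i\in M_1^{\mathbb Q}(\mathfrak B_i)$, $i=1,2$, admits a common extension to a measure $\nu\in M_r^{\mathbb Q}(\langle\mathfrak B_1\cup\mathfrak B_2\rangle)$. Here $\nu_1,\nu_2$ are consistent if $\nu_1(B)=\nu_2(B)$ for every $B\in\mathfrak B_1\cap\mathfrak B_2$. $\mathrm{MA}(\kappa)$: for every nonempty partially ordered set $(\mathbb P,\le)$ satisfying ccc (every uncountable subset of $\mathbb P$ contains two distinct elements $p_1,p_2$ having a common upper bound $q\in\mathbb P$) and every family $\{\mathbb D_\xi:\xi<\kappa\}$ of dense subsets of $\mathbb P$ (for every $p\in \mathbb P$ there is $d\in \mathbb D_\xi$ with $p\le d$), there is a directed set $\mathbb G\subseteq\mathbb P$ (any $p_1,p_2\in\mathbb G$ have an upper bound in $\mathbb G$) with $\mathbb G\cap\mathbb D_\xi\neq\emptyset$ for every $\xi<\kappa$. *)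

theory Defs
  imports "HOL-Analysis.Analysis"
begin

unbundle cardinal_syntax

section \<open>Finitely additive signed measures on an algebra of sets\<close>

text \<open>
  A measure on an algebra \<open>\<AA>\<close> of subsets of \<open>X\<close> is a total function of type
  \<open>'a set \<Rightarrow> real\<close>. Its values outside \<open>\<AA>\<close> are irrelevant: no notion below looks at them.
\<close>

definition variation_sums :: "'a set set \<Rightarrow> ('a set \<Rightarrow> real) \<Rightarrow> 'a set \<Rightarrow> real set" where
  "variation_sums \<AA> \<mu> E =
     {(\<Sum>P\<in>\<P>. \<bar>\<mu> P\<bar>) | \<P>. finite \<P> \<and> \<P> \<subseteq> \<AA> \<and> partition_on E \<P>}"

text \<open>The supremum is meaningful only for \<open>\<mu>\<close> of bounded variation; hence \<open>bdd_above\<close> in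
  \<open>bv_measures\<close>.\<close>

definition variation :: "'a set set \<Rightarrow> ('a set \<Rightarrow> real) \<Rightarrow> 'a set \<Rightarrow> real" where
  "variation \<AA> \<mu> E = Sup (variation_sums \<AA> \<mu> E)"

definition bv_measures :: "'a set \<Rightarrow> 'a set set \<Rightarrow> ('a set \<Rightarrow> real) set" where
  "bv_measures X \<AA> = {\<mu>. additive \<AA> \<mu> \<and> bdd_above (variation_sums \<AA> \<mu> X)}"

definition bv_ball :: "'a set \<Rightarrow> 'a set set \<Rightarrow> real \<Rightarrow> ('a set \<Rightarrow> real) set" where
  "bv_ball X \<AA> r = {\<mu> \<in> bv_measures X \<AA>. variation \<AA> \<mu> X \<le> r}"

definition rat_bv_ball :: "'a set \<Rightarrow> 'a set set \<Rightarrow> real \<Rightarrow> ('a set \<Rightarrow> real) set" where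
  "rat_bv_ball X \<BB> r = {\<mu> \<in> bv_ball X \<BB> r. \<forall>B\<in>\<BB>. \<mu> B \<in> \<rat>}"

definition dist_on :: "'a set set \<Rightarrow> ('a set \<Rightarrow> real) \<Rightarrow> ('a set \<Rightarrow> real) \<Rightarrow> real" where
  "dist_on \<BB> \<phi> \<psi> = (SUP B\<in>\<BB>. \<bar>\<phi> B - \<psi> B\<bar>)"

definition finite_subalgebra :: "'a set \<Rightarrow> 'a set set \<Rightarrow> 'a set set \<Rightarrow> bool" where
  "finite_subalgebra X \<AA> \<BB> \<longleftrightarrow> finite \<BB> \<and> \<BB> \<subseteq> \<AA> \<and> algebra X \<BB>"


section \<open>Approximation property and local extension property\<close>

definition approximation_property :: "'a set \<Rightarrow> 'a set set \<Rightarrow> bool" where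
  "approximation_property X \<AA> \<longleftrightarrow>
     (\<forall>\<phi> :: nat \<Rightarrow> 'a set \<Rightarrow> real.
        (\<forall>n. \<forall>a\<in>\<AA>. \<phi> n a \<in> {-1..1}) \<and>
        (\<forall>\<BB>. finite_subalgebra X \<AA> \<BB> \<longrightarrow>
           (\<lambda>n. INF \<mu>\<in>bv_ball X \<AA> 1. dist_on \<BB> \<mu> (\<phi> n)) \<longlonglongrightarrow> 0)
        \<longrightarrow> (\<exists>\<nu> :: nat \<Rightarrow> 'a set \<Rightarrow> real.
               (\<exists>r. \<forall>n. \<nu> n \<in> bv_ball X \<AA> r) \<and>
               (\<forall>a\<in>\<AA>. (\<lambda>n. \<phi> n a - \<nu> n a) \<longlonglongrightarrow> 0)))"

text \<open>\<open>algebra X hull F\<close> is the intersection of all algebras of subsets of \<open>X\<close> that contain \<open>F\<close>,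
  i.e. the algebra generated by \<open>F\<close>.\<close>

definition LEP :: "'a set \<Rightarrow> 'a set set \<Rightarrow> real \<Rightarrow> bool" where
  "LEP X \<AA> r \<longleftrightarrow>
     (\<exists>\<B>. (\<forall>\<BB>\<in>\<B>. finite_subalgebra X \<AA> \<BB>) \<and>
          (\<forall>\<CC>. finite_subalgebra X \<AA> \<CC> \<longrightarrow> (\<exists>\<BB>\<in>\<B>. \<CC> \<subseteq> \<BB>)) \<and>
          (\<forall>\<B>'\<subseteq>\<B>. uncountable \<B>' \<longrightarrow>
             (\<exists>\<BB>\<^sub>1\<in>\<B>'. \<exists>\<BB>\<^sub>2\<in>\<B>'. \<BB>\<^sub>1 \<noteq> \<BB>\<^sub>2 \<and>
                (\<forall>\<nu>\<^sub>1\<in>rat_bv_ball X \<BB>\<^sub>1 1. \<forall>\<nu>\<^sub>2\<in>rat_bv_ball X \<BB>\<^sub>2 1.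
                   (\<forall>B\<in>\<BB>\<^sub>1 \<inter> \<BB>\<^sub>2. \<nu>\<^sub>1 B = \<nu>\<^sub>2 B) \<longrightarrow>
                   (\<exists>\<nu>\<in>rat_bv_ball X (algebra X hull (\<BB>\<^sub>1 \<union> \<BB>\<^sub>2)) r.
                      (\<forall>B\<in>\<BB>\<^sub>1. \<nu> B = \<nu>\<^sub>1 B) \<and> (\<forall>B\<in>\<BB>\<^sub>2. \<nu> B = \<nu>\<^sub>2 B))))))"


section \<open>The Stone space\<close>

definition ultrafilters_of :: "'a set \<Rightarrow> 'a set set \<Rightarrow> 'a set set set" where
  "ultrafilters_of X \<AA> =
     {U. U \<subseteq> \<AA> \<and> X \<in> U \<and> {} \<notin> U \<and>
         (\<forall>A\<in>U. \<forall>B\<in>U. A \<inter> B \<in> U) \<and>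
         (\<forall>A\<in>U. \<forall>B\<in>\<AA>. A \<subseteq> B \<longrightarrow> B \<in> U) \<and>
         (\<forall>A\<in>\<AA>. A \<in> U \<or> X - A \<in> U)}"

definition stone_space :: "'a set \<Rightarrow> 'a set set \<Rightarrow> 'a set set topology" where
  "stone_space X \<AA> =
     topology_generated_by ((\<lambda>A. {U \<in> ultrafilters_of X \<AA>. A \<in> U}) ` \<AA>)"

lemma topspace_stone_space:
  assumes "algebra X \<AA>"
  shows "topspace (stone_space X \<AA>) = ultrafilters_of X \<AA>"
proof -
  have "X \<in> \<AA>" using assms by (rule algebra.top)
  then show ?thesis
    unfolding stone_space_def topology_generated_by_topspace
    by (auto simp: ultrafilters_of_def)
qed


section \<open>Martin's axiom\<close>

text \<open>
  Posets are written as a carrier \<open>P\<close> with an order relation \<open>le\<close>, where \<open>(p, q) \<in> le\<close> means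
  \<open>p \<le> q\<close> and stronger conditions are larger.
\<close>

definition ccc :: "'p set \<Rightarrow> 'p rel \<Rightarrow> bool" where
  "ccc P le \<longleftrightarrow>
     (\<forall>Q\<subseteq>P. uncountable Q \<longrightarrow>
        (\<exists>p\<^sub>1\<in>Q. \<exists>p\<^sub>2\<in>Q. p\<^sub>1 \<noteq> p\<^sub>2 \<and> (\<exists>q\<in>P. (p\<^sub>1, q) \<in> le \<and> (p\<^sub>2, q) \<in> le)))"

definition dense_in :: "'p set \<Rightarrow> 'p rel \<Rightarrow> 'p set \<Rightarrow> bool" where
  "dense_in P le D \<longleftrightarrow> D \<subseteq> P \<and> (\<forall>p\<in>P. \<exists>d\<in>D. (p, d) \<in> le)"

definition directed_in :: "'p set \<Rightarrow> 'p rel \<Rightarrow> 'p set \<Rightarrow> bool" where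
  "directed_in P le G \<longleftrightarrow> G \<subseteq> P \<and> (\<forall>p\<^sub>1\<in>G. \<forall>p\<^sub>2\<in>G. \<exists>q\<in>G. (p\<^sub>1, q) \<in> le \<and> (p\<^sub>2, q) \<in> le)"

text \<open>
  The cardinal \<open>\<kappa>\<close> is a cardinal order relation in the sense of \<^const>\<open>Card_order\<close>; the indices
  \<open>\<xi> < \<kappa>\<close> are the elements of its field. A formula of HOL cannot quantify over types, so the
  posets range over all subsets of a type \<open>'p\<close>, which is a parameter. On a type of fewer than
  \<open>\<kappa>\<close> elements the axiom may be much weaker than Martin's axiom, even trivially true, so uses of
  it must require \<open>\<kappa> \<le>o |UNIV :: 'p set|\<close>.
\<close>

definition martins_axiom :: "'p itself \<Rightarrow> 'k rel \<Rightarrow> bool" where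
  "martins_axiom (_ :: 'p itself) \<kappa> \<longleftrightarrow>
     (\<forall>(P :: 'p set) le (D :: 'k \<Rightarrow> 'p set).
        P \<noteq> {} \<and> partial_order_on P le \<and> ccc P le \<and>
        (\<forall>\<xi>\<in>Field \<kappa>. dense_in P le (D \<xi>))
        \<longrightarrow> (\<exists>G. directed_in P le G \<and> (\<forall>\<xi>\<in>Field \<kappa>. G \<inter> D \<xi> \<noteq> {})))"

end

theory Submission
  imports Defs
begin

text \<open>
  Fix functions \<open>\<phi> k\<close> that are approximable by measures of norm at most 1 on every finite subalgebra.
  A set of ultrafilters that is dense in the Stone space and countable yields countably many rational
  combinations of point measures, and each rational measure on a finite subalgebra extends to one of
  them with the same norm (\<open>rational_measure_extension\<close>). So the sought measures \<open>\<nu> k\<close> can be taken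
  from a countable pool.
  
  They are produced by a generic filter. A condition \<open>(\<BB>, m, l)\<close> consists of a finite subalgebra \<open>\<BB>\<close> from the
  family that witnesses LEP, a precision \<open>m\<close>, and a finite list \<open>l\<close> of pool measures, the values
  \<open>\<nu> 0, \<dots>, \<nu> (length l - 1)\<close> fixed so far. It promises that all later \<open>\<nu> k\<close> will be within \<open>1/(m+1)\<close>
  of \<open>\<phi> k\<close> on \<open>\<BB>\<close>. Conditions are required to be credible: from index \<open>length l\<close> on, measures of norm
  at most 1 come nine times closer to \<open>\<phi> k\<close> on \<open>\<BB>\<close> than promised. Since every finite subalgebra is eventually
  approximated to any accuracy, each condition can be extended so as to have a given set in its
  subalgebra, arbitrary precision and arbitrary length (\<open>extend_condition\<close>). A filter that meets the
  corresponding dense sets yields the measures (\<open>measures_of_generic\<close>).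
  
  The countable chain condition is where LEP enters. Among uncountably many conditions, uncountably
  many share \<open>m\<close> and \<open>l\<close>, for there are only countably many such pairs; LEP selects two of these, with
  subalgebras \<open>\<BB>\<^sub>1\<close> and \<open>\<BB>\<^sub>2\<close>. The credible approximations \<open>\<tau>\<^sub>1\<close> on \<open>\<BB>\<^sub>1\<close> and \<open>\<tau>\<^sub>2\<close> on \<open>\<BB>\<^sub>2\<close> need not agree on
  \<open>\<BB>\<^sub>1 \<inter> \<BB>\<^sub>2\<close>, but both are close to \<open>\<phi> k\<close> there, so a measure of small norm corrects the discrepancy.
  After rescaling to norm at most 1, LEP extends both simultaneously to a measure of norm at most \<open>r\<close>,
  and the accumulated error is at most nine times the original one (\<open>common_approximation\<close>). Hence the two
  conditions have a common extension (\<open>compatible_conditions\<close>).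
  
  There are at most \<open>|\<AA>|\<close> conditions when \<open>\<AA>\<close> is infinite, so the poset can be copied into the type on which
  Martin's axiom is assumed. For finite \<open>\<AA>\<close> the hypothesis on \<open>\<phi>\<close> can be applied to \<open>\<AA>\<close> itself.
\<close>

section \<open>Finite subalgebras and their atoms\<close>

lemma algebra_Inter:
  assumes "algebra X \<BB>" "finite \<F>" "\<F> \<noteq> {}" "\<F> \<subseteq> \<BB>"
  shows "\<Inter>\<F> \<in> \<BB>"
  using assms(2,3,4) by (induction rule: finite_ne_induct) (use assms(1) in \<open>auto simp: algebra_iff_Int\<close>)

lemma algebra_inter:
  assumes "algebra X \<BB>" "algebra X \<CC>"
  shows "algebra X (\<BB> \<inter> \<CC>)"
  using assms by (auto simp: algebra_iff_Int)

text \<open>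
  Points of \<open>X\<close> that lie in the same members of \<open>S\<close> cannot be separated by the generated algebra. Sending a
  family \<open>T\<close> of subsets of \<open>S\<close> to the set of points whose trace \<open>{s \<in> S. x \<in> s}\<close> belongs to \<open>T\<close> turns Boolean
  operations on families into those on sets, so its range is an algebra with at most \<open>2 ^ 2 ^ card S\<close> members.
\<close>

lemma finite_subalgebra_hull:
  assumes "algebra X \<AA>" "finite S" "S \<subseteq> \<AA>"
  shows "finite_subalgebra X \<AA> (algebra X hull S)"
proof -
  have sub: "S \<subseteq> Pow X" using assms by (auto simp: algebra_iff_Int)
  let ?f = "\<lambda>T. {x\<in>X. {s\<in>S. x \<in> s} \<in> T}"
  have "algebra X (?f ` Pow (Pow S))"
    unfolding algebra_iff_Un
  proof (intro conjI ballI)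
    show "{} \<in> ?f ` Pow (Pow S)" by (intro image_eqI[of _ _ "{}"]) auto
    fix a assume "a \<in> ?f ` Pow (Pow S)"
    then obtain T where T: "T \<subseteq> Pow S" "a = ?f T" by auto
    then show "X - a \<in> ?f ` Pow (Pow S)"
      by (intro image_eqI[of _ _ "Pow S - T"]) auto
    fix b assume "b \<in> ?f ` Pow (Pow S)"
    then obtain T' where "T' \<subseteq> Pow S" "b = ?f T'" by auto
    with T show "a \<union> b \<in> ?f ` Pow (Pow S)"
      by (intro image_eqI[of _ _ "T \<union> T'"]) auto
  qed auto
  moreover have "S \<subseteq> ?f ` Pow (Pow S)"
  proof
    fix s assume "s \<in> S"
    then show "s \<in> ?f ` Pow (Pow S)"
      using sub by (intro image_eqI[of _ _ "{U. U \<subseteq> S \<and> s \<in> U}"]) auto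
  qed
  ultimately have "algebra X hull S \<subseteq> ?f ` Pow (Pow S)" by (intro hull_minimal)
  then have "finite (algebra X hull S)"
    using assms(2) by (meson finite_Pow_iff finite_imageI finite_subset)
  moreover have "algebra X hull S \<subseteq> \<AA>" using assms by (intro hull_minimal)
  moreover have "algebra X (algebra X hull S)"
  proof -
    have "{T. algebra X T \<and> S \<subseteq> T} \<noteq> {}" using assms by blast
    moreover have "algebra X (\<Inter>\<T>)" if "\<T> \<noteq> {}" "\<And>T. T \<in> \<T> \<Longrightarrow> algebra X T" for \<T>
      unfolding algebra_iff_Un
    proof (intro conjI ballI)
      show "\<Inter>\<T> \<subseteq> Pow X" using that by (force simp: algebra_iff_Un)
    qed (use that in \<open>auto simp: algebra_iff_Un\<close>)
    ultimately show ?thesis unfolding hull_def by (metis (mono_tags, lifting) mem_Collect_eq)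
  qed
  ultimately show ?thesis by (simp add: finite_subalgebra_def)
qed

definition atom_of :: "'a set set \<Rightarrow> 'a \<Rightarrow> 'a set" where
  "atom_of \<BB> x = \<Inter>{B \<in> \<BB>. x \<in> B}"

definition atoms :: "'a set \<Rightarrow> 'a set set \<Rightarrow> 'a set set" where
  "atoms X \<BB> = atom_of \<BB> ` X"

context
  fixes X :: "'a set" and \<BB> :: "'a set set"
  assumes fin: "finite \<BB>" and alg: "algebra X \<BB>"
begin

lemma atom_of_mem: "x \<in> X \<Longrightarrow> atom_of \<BB> x \<in> \<BB>"
  unfolding atom_of_def using fin alg algebra.top[OF alg]
  by (intro algebra_Inter[OF alg]) auto

lemma atoms_subset: "atoms X \<BB> \<subseteq> \<BB>"
  using atom_of_mem by (auto simp: atoms_def)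

lemma finite_atoms: "finite (atoms X \<BB>)"
  using atoms_subset fin finite_subset by blast

lemma atom_below_or_disjoint:
  assumes "P \<in> atoms X \<BB>" "B \<in> \<BB>" "\<not> P \<subseteq> B"
  shows "P \<inter> B = {}"
proof -
  obtain x where x: "x \<in> X" "P = atom_of \<BB> x" using assms by (auto simp: atoms_def)
  have "x \<notin> B" using assms x by (auto simp: atom_of_def)
  moreover have "X - B \<in> \<BB>" using alg assms(2) by (auto simp: algebra_iff_Un)
  ultimately show ?thesis using x by (auto simp: atom_of_def)
qed

lemma partition_on_atoms: "partition_on X (atoms X \<BB>)"
proof -
  have "P = Q" if "P \<in> atoms X \<BB>" "Q \<in> atoms X \<BB>" "P \<inter> Q \<noteq> {}" for P Q
  proof -
    have "P \<in> \<BB>" "Q \<in> \<BB>" using that atoms_subset by auto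
    then show ?thesis
      using atom_below_or_disjoint[of P Q] atom_below_or_disjoint[of Q P] that by auto
  qed
  moreover have "\<Union>(atoms X \<BB>) \<subseteq> X" using atoms_subset alg by (auto simp: algebra_iff_Un)
  moreover have "x \<in> atom_of \<BB> x" for x by (simp add: atom_of_def)
  then have "X \<subseteq> \<Union>(atoms X \<BB>)" "{} \<notin> atoms X \<BB>" unfolding atoms_def by blast+
  ultimately show ?thesis
    unfolding partition_on_def disjoint_def by blast
qed

lemma Union_atoms_below:
  assumes "B \<in> \<BB>" shows "\<Union>{P \<in> atoms X \<BB>. P \<subseteq> B} = B"
proof -
  have "B \<subseteq> \<Union>(atoms X \<BB>)"
    using assms alg partition_on_atoms by (auto simp: partition_on_def algebra_iff_Un)
  then show ?thesis using atom_below_or_disjoint[OF _ assms] by blast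
qed

end

section \<open>Additive functions and the variation norm\<close>

lemma additive_empty:
  assumes "algebra X \<AA>" "additive \<AA> \<mu>"
  shows "\<mu> {} = (0::real)"
proof -
  have "{} \<in> \<AA>" using assms by (auto simp: algebra_iff_Un)
  then have "\<mu> ({} \<union> {}) = \<mu> {} + \<mu> {}" using assms(2) unfolding additive_def by blast
  then show ?thesis by simp
qed

lemma additive_Union:
  fixes \<mu> :: "'a set \<Rightarrow> real"
  assumes "algebra X \<AA>" "additive \<AA> \<mu>" "finite \<F>" "\<F> \<subseteq> \<AA>" "disjoint \<F>"
  shows "\<mu> (\<Union>\<F>) = (\<Sum>P\<in>\<F>. \<mu> P)"
  using assms(3-5)
proof (induction rule: finite_induct)
  case empty
  then show ?case using additive_empty[OF assms(1,2)] by simp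
next
  case (insert P \<F>)
  have "\<mu> (P \<union> \<Union>\<F>) = \<mu> P + \<mu> (\<Union>\<F>)"
  proof (rule assms(2)[unfolded additive_def, rule_format])
    show "\<Union>\<F> \<in> \<AA>"
      using insert by (intro ring_of_sets.finite_Union[OF algebra.axioms(1)[OF assms(1)]]) auto
    show "P \<inter> \<Union>\<F> = {}" using insert.prems insert.hyps by (auto simp: disjoint_def)
  qed (use insert in auto)
  then show ?case using insert by (simp add: disjoint_def)
qed

text \<open>
  A measure on a finite algebra is determined by its values on the atoms, which may be prescribed
  freely; all later constructions of measures work on atoms.
\<close>

lemma measure_eq_sum_atoms:
  fixes \<mu> :: "'a set \<Rightarrow> real"
  assumes "finite \<BB>" "algebra X \<BB>" "additive \<BB> \<mu>" "B \<in> \<BB>"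
  shows "\<mu> B = (\<Sum>P\<in>{P \<in> atoms X \<BB>. P \<subseteq> B}. \<mu> P)"
proof -
  have "\<mu> (\<Union>{P \<in> atoms X \<BB>. P \<subseteq> B}) = (\<Sum>P\<in>{P \<in> atoms X \<BB>. P \<subseteq> B}. \<mu> P)"
    using finite_atoms[OF assms(1,2)] atoms_subset[OF assms(1,2)]
      partition_on_atoms[OF assms(1,2)]
    by (intro additive_Union[OF assms(2,3)]) (auto simp: partition_on_def disjoint_def)
  then show ?thesis using Union_atoms_below[OF assms(1,2,4)] by simp
qed

lemma measure_eq_if_eq_on_atoms:
  fixes \<mu> :: "'a set \<Rightarrow> real"
  assumes "finite \<BB>" "algebra X \<BB>" "additive \<BB> \<mu>" "additive \<BB> \<nu>"
    and "\<And>P. P \<in> atoms X \<BB> \<Longrightarrow> \<mu> P = \<nu> P" "B \<in> \<BB>"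
  shows "\<mu> B = \<nu> B"
  using measure_eq_sum_atoms[OF assms(1,2,3,6)] measure_eq_sum_atoms[OF assms(1,2,4,6)] assms(5)
  by simp

text \<open>
  Bounding every variation sum by \<open>s\<close> expresses boundedness and the bound on the supremum at once.
\<close>

lemma bv_ball_iff:
  assumes "algebra X \<AA>"
  shows "\<mu> \<in> bv_ball X \<AA> s \<longleftrightarrow> additive \<AA> \<mu> \<and>
    (\<forall>\<P>. finite \<P> \<and> \<P> \<subseteq> \<AA> \<and> partition_on X \<P> \<longrightarrow> (\<Sum>P\<in>\<P>. \<bar>\<mu> P\<bar>) \<le> s)"
proof -
  have "partition_on X ({X} - {{}})" by (auto simp: partition_on_def disjoint_def)
  moreover have "{X} - {{}} \<subseteq> \<AA>" using algebra.top[OF assms] by auto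
  ultimately have ne: "variation_sums \<AA> \<mu> X \<noteq> {}"
    unfolding variation_sums_def by (smt (verit, ccfv_threshold) Collect_empty_eq finite.emptyI finite_Diff finite_insert)
  have "(bdd_above (variation_sums \<AA> \<mu> X) \<and> variation \<AA> \<mu> X \<le> s) \<longleftrightarrow>
      (\<forall>v\<in>variation_sums \<AA> \<mu> X. v \<le> s)"
    unfolding variation_def using cSup_le_iff[OF ne] by (meson bdd_above.I)
  then show ?thesis
    unfolding bv_ball_def bv_measures_def by (auto simp: variation_sums_def)
qed

lemma bv_ball_sum_le:
  assumes "algebra X \<AA>" "\<mu> \<in> bv_ball X \<AA> s" "finite \<P>" "\<P> \<subseteq> \<AA>" "partition_on X \<P>"
  shows "(\<Sum>P\<in>\<P>. \<bar>\<mu> P\<bar>) \<le> s"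
  using assms by (simp add: bv_ball_iff)

lemma additive_subset: "additive \<AA> \<mu> \<Longrightarrow> \<BB> \<subseteq> \<AA> \<Longrightarrow> additive \<BB> \<mu>"
  by (auto simp: additive_def)

lemma bv_ball_subalgebra:
  assumes "algebra X \<AA>" "algebra X \<BB>" "\<BB> \<subseteq> \<AA>" "\<mu> \<in> bv_ball X \<AA> s"
  shows "\<mu> \<in> bv_ball X \<BB> s"
  using assms additive_subset[of \<AA> \<mu> \<BB>] by (auto simp: bv_ball_iff)

lemma bv_ball_mono:
  assumes "algebra X \<AA>" "\<mu> \<in> bv_ball X \<AA> s" "s \<le> t"
  shows "\<mu> \<in> bv_ball X \<AA> t"
  using assms by (auto simp: bv_ball_iff intro: order_trans)

lemma bv_ball_add:
  assumes "algebra X \<AA>" "\<mu> \<in> bv_ball X \<AA> s" "\<nu> \<in> bv_ball X \<AA> t"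
  shows "(\<lambda>A. \<mu> A + \<nu> A) \<in> bv_ball X \<AA> (s + t)"
  unfolding bv_ball_iff[OF assms(1)]
proof (intro conjI allI impI)
  show "additive \<AA> (\<lambda>A. \<mu> A + \<nu> A)"
    using assms by (auto simp: bv_ball_iff additive_def)
  fix \<P> assume P: "finite \<P> \<and> \<P> \<subseteq> \<AA> \<and> partition_on X \<P>"
  have "(\<Sum>P\<in>\<P>. \<bar>\<mu> P + \<nu> P\<bar>) \<le> (\<Sum>P\<in>\<P>. \<bar>\<mu> P\<bar>) + (\<Sum>P\<in>\<P>. \<bar>\<nu> P\<bar>)"
    unfolding sum.distrib[symmetric] by (intro sum_mono) auto
  also have "\<dots> \<le> s + t" using assms P by (intro add_mono) (auto simp: bv_ball_iff)
  finally show "(\<Sum>P\<in>\<P>. \<bar>\<mu> P + \<nu> P\<bar>) \<le> s + t" .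
qed

lemma bv_ball_scale:
  assumes "algebra X \<AA>" "\<mu> \<in> bv_ball X \<AA> s"
  shows "(\<lambda>A. c * \<mu> A) \<in> bv_ball X \<AA> (\<bar>c\<bar> * s)"
  unfolding bv_ball_iff[OF assms(1)]
proof (intro conjI allI impI)
  show "additive \<AA> (\<lambda>A. c * \<mu> A)"
    using assms(2) unfolding bv_ball_iff[OF assms(1)] additive_def by (simp add: distrib_left)
  fix \<P> assume P: "finite \<P> \<and> \<P> \<subseteq> \<AA> \<and> partition_on X \<P>"
  have "(\<Sum>P\<in>\<P>. \<bar>c * \<mu> P\<bar>) = \<bar>c\<bar> * (\<Sum>P\<in>\<P>. \<bar>\<mu> P\<bar>)"
    by (simp add: abs_mult sum_distrib_left)
  also have "\<dots> \<le> \<bar>c\<bar> * s"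
    using P by (intro mult_left_mono[OF bv_ball_sum_le[OF assms]] abs_ge_zero) auto
  finally show "(\<Sum>P\<in>\<P>. \<bar>c * \<mu> P\<bar>) \<le> \<bar>c\<bar> * s" .
qed

lemma abs_le_of_bv_ball:
  assumes "algebra X \<AA>" "\<mu> \<in> bv_ball X \<AA> s" "A \<in> \<AA>"
  shows "\<bar>\<mu> A\<bar> \<le> s"
proof -
  have sub: "A \<subseteq> X" and c: "X - A \<in> \<AA>" using assms by (auto simp: algebra_iff_Un)
  have e: "\<mu> {} = 0" using additive_empty[OF assms(1)] assms by (auto simp: bv_ball_iff)
  have "partition_on X ({A, X - A} - {{}})"
    using sub by (auto simp: partition_on_def disjoint_def)
  then have "(\<Sum>P\<in>{A, X - A} - {{}}. \<bar>\<mu> P\<bar>) \<le> s"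
    using assms(3) c by (intro bv_ball_sum_le[OF assms(1,2)]) auto
  moreover have "(\<Sum>P\<in>{A, X - A} - {{}}. \<bar>\<mu> P\<bar>) = (\<Sum>P\<in>{A, X - A}. \<bar>\<mu> P\<bar>)"
    using e by (intro sum.mono_neutral_left) auto
  moreover have "\<bar>\<mu> A\<bar> \<le> (\<Sum>P\<in>{A, X - A}. \<bar>\<mu> P\<bar>)"
    by (rule member_le_sum) auto
  ultimately show ?thesis by linarith
qed

lemma sum_atoms_le_of_bv_ball:
  assumes "finite \<BB>" "algebra X \<BB>" "\<mu> \<in> bv_ball X \<BB> s"
  shows "(\<Sum>P\<in>atoms X \<BB>. \<bar>\<mu> P\<bar>) \<le> s"
  using finite_atoms[OF assms(1,2)] atoms_subset[OF assms(1,2)] partition_on_atoms[OF assms(1,2)]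
  by (rule bv_ball_sum_le[OF assms(2,3)])

text \<open>
  The atoms of negative value form one member of \<open>\<BB>\<close>, the remaining atoms another, so uniform
  smallness of \<open>\<mu>\<close> on \<open>\<BB>\<close> controls its norm. This Hahn decomposition argument turns a uniform error
  into a norm bound.
\<close>

lemma sum_atoms_le_sup:
  fixes \<mu> :: "'a set \<Rightarrow> real"
  assumes "finite \<BB>" "algebra X \<BB>" "additive \<BB> \<mu>" "\<And>B. B \<in> \<BB> \<Longrightarrow> \<bar>\<mu> B\<bar> \<le> \<delta>"
  shows "(\<Sum>P\<in>atoms X \<BB>. \<bar>\<mu> P\<bar>) \<le> 2 * \<delta>"
proof -
  let ?A = "atoms X \<BB>"
  let ?N = "{P \<in> ?A. \<mu> P < 0}" and ?P = "{P \<in> ?A. \<not> \<mu> P < 0}"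
  note f = finite_atoms[OF assms(1,2)]
  have sub: "\<mu> (\<Union>F) = sum \<mu> F" "\<bar>\<mu> (\<Union>F)\<bar> \<le> \<delta>" if "F \<subseteq> ?A" for F
  proof -
    have F: "finite F" "F \<subseteq> \<BB>" "disjoint F"
      using that f atoms_subset[OF assms(1,2)] partition_on_atoms[OF assms(1,2)]
      by (auto simp: partition_on_def intro: finite_subset pairwise_subset)
    show "\<mu> (\<Union>F) = sum \<mu> F" using additive_Union[OF assms(2,3) F] .
    show "\<bar>\<mu> (\<Union>F)\<bar> \<le> \<delta>" using ring_of_sets.finite_Union[OF algebra.axioms(1)[OF assms(2)] F(1,2)] assms(4) by blast
  qed
  have "(\<Sum>P\<in>?A. \<bar>\<mu> P\<bar>) = (\<Sum>P\<in>?P. \<bar>\<mu> P\<bar>) + (\<Sum>P\<in>?N. \<bar>\<mu> P\<bar>)"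
    using f by (subst sum.union_disjoint[symmetric]) (auto intro!: sum.cong)
  moreover have "(\<Sum>P\<in>?P. \<bar>\<mu> P\<bar>) = sum \<mu> ?P" by (intro sum.cong) auto
  moreover have "(\<Sum>P\<in>?N. \<bar>\<mu> P\<bar>) = - sum \<mu> ?N"
    unfolding sum_negf[symmetric] by (intro sum.cong) auto
  moreover have "sum \<mu> ?P \<le> \<delta>" using sub[of ?P] by force
  moreover have "- sum \<mu> ?N \<le> \<delta>" using sub[of ?N] by force
  ultimately show ?thesis by linarith
qed

section \<open>Rational combinations of point measures\<close>

text \<open>
  An ultrafilter \<open>U\<close> acts as the point measure \<open>indicator U\<close>. Combinations are coded by lists so that
  countability of the set of measures follows from that of \<open>\<rat> \<times> S\<close>.
\<close>

definition rational_point_measures :: "'a set set set \<Rightarrow> ('a set \<Rightarrow> real) set" where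
  "rational_point_measures S =
     (\<lambda>l A. \<Sum>(q, U)\<leftarrow>l. q * indicator U A) ` lists (\<rat> \<times> S)"

lemma countable_rational_point_measures:
  "countable S \<Longrightarrow> countable (rational_point_measures S)"
  unfolding rational_point_measures_def by (intro countable_image countable_lists countable_SIGMA countable_rat)

lemma ultrafilter_additive:
  assumes "algebra X \<AA>" "U \<in> ultrafilters_of X \<AA>"
  shows "additive \<AA> (indicator U :: 'a set \<Rightarrow> real)"
  unfolding additive_def
proof (intro ballI impI)
  fix A B assume AB: "A \<in> \<AA>" "B \<in> \<AA>" "A \<inter> B = {}"
  note U = assms(2)[unfolded ultrafilters_of_def, simplified]
  have un: "A \<union> B \<in> \<AA>" and sub: "B \<subseteq> X" using assms AB by (auto simp: algebra_iff_Un)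
  have nb: "\<not> (A \<in> U \<and> B \<in> U)" using U AB by metis
  have "A \<union> B \<in> U" if "A \<in> U \<or> B \<in> U" using U that un by blast
  moreover have "B \<in> U" if "A \<union> B \<in> U" "A \<notin> U"
  proof -
    have "X - A \<in> U" using U AB that by blast
    then have "(X - A) \<inter> (A \<union> B) \<in> U" using U that by blast
    moreover have "(X - A) \<inter> (A \<union> B) = B" using AB sub by auto
    ultimately show ?thesis by simp
  qed
  ultimately show "(indicator U (A \<union> B) :: real) = indicator U A + indicator U B"
    using nb by (auto simp: indicator_def)
qed

text \<open>
  Disjoint sets cannot both belong to \<open>U\<close>: a point measure has norm at most 1.
\<close>

lemma ultrafilter_sum_partition_le:
  assumes "U \<in> ultrafilters_of X \<AA>" "finite \<P>" "disjoint \<P>"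
  shows "(\<Sum>Q\<in>\<P>. indicator U Q :: real) \<le> 1"
proof -
  have "card (\<P> \<inter> U) \<le> Suc 0"
  proof (subst card_le_Suc0_iff_eq)
    show "\<forall>P\<in>\<P> \<inter> U. \<forall>Q\<in>\<P> \<inter> U. P = Q"
    proof (intro ballI, rule ccontr)
      fix P Q assume PQ: "P \<in> \<P> \<inter> U" "Q \<in> \<P> \<inter> U" "P \<noteq> Q"
      then have "P \<inter> Q = {}" using assms(3) by (auto simp: disjoint_def)
      moreover have "P \<inter> Q \<in> U" "{} \<notin> U" using PQ assms(1) by (auto simp: ultrafilters_of_def)
      ultimately show False by simp
    qed
  qed (use assms in simp)
  moreover have "(\<Sum>Q\<in>\<P>. indicator U Q :: real) = real (card (\<P> \<inter> U))"
    using assms(2) by (simp add: indicator_def of_bool_def sum.If_cases Int_def)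
  ultimately show ?thesis by simp
qed

text \<open>
  Choose for each atom an ultrafilter in \<open>S\<close> that contains it and give it the prescribed mass. No atom
  lies in the ultrafilter of another one, so the values on atoms come out right, and the norm on all of
  \<open>\<AA>\<close> is at most the sum of the masses.
\<close>

lemma point_measure_with_given_atoms:
  assumes alg: "algebra X \<AA>" and sub: "finite_subalgebra X \<AA> \<BB>"
    and S: "S \<subseteq> ultrafilters_of X \<AA>" and dense: "\<And>A. A \<in> \<AA> \<Longrightarrow> A \<noteq> {} \<Longrightarrow> \<exists>U\<in>S. A \<in> U"
    and c: "\<And>P. P \<in> atoms X \<BB> \<Longrightarrow> c P \<in> \<rat>"
  obtains \<tau> where "\<tau> \<in> rational_point_measures S"
    and "\<tau> \<in> rat_bv_ball X \<AA> (\<Sum>P\<in>atoms X \<BB>. \<bar>c P\<bar>)"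
    and "\<And>P. P \<in> atoms X \<BB> \<Longrightarrow> \<tau> P = c P"
proof -
  let ?A = "atoms X \<BB>"
  have B: "finite \<BB>" "algebra X \<BB>" "\<BB> \<subseteq> \<AA>" using sub by (auto simp: finite_subalgebra_def)
  note fA = finite_atoms[OF B(1,2)] and sA = atoms_subset[OF B(1,2)]
    and pA = partition_on_atoms[OF B(1,2)]
  have "\<exists>U\<in>S. P \<in> U" if "P \<in> ?A" for P
    using that sA B pA by (intro dense) (auto simp: partition_on_def)
  then obtain u where u: "\<And>P. P \<in> ?A \<Longrightarrow> u P \<in> S \<and> P \<in> u P" by metis
  define \<tau> where "\<tau> A = (\<Sum>P\<in>?A. c P * indicator (u P) A)" for A
  obtain ps where ps: "set ps = ?A" "distinct ps" using fA finite_distinct_list by blast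
  have "\<tau> = (\<lambda>A. \<Sum>(q, U)\<leftarrow>map (\<lambda>P. (c P, u P)) ps. q * indicator U A)"
    unfolding \<tau>_def using ps
    by (auto simp: fun_eq_iff comp_def sum_list_distinct_conv_sum_set)
  moreover have "map (\<lambda>P. (c P, u P)) ps \<in> lists (\<rat> \<times> S)" using ps u c by auto
  ultimately have 1: "\<tau> \<in> rational_point_measures S"
    unfolding rational_point_measures_def by blast
  have U: "u P \<in> ultrafilters_of X \<AA>" if "P \<in> ?A" for P using u S that by blast
  have "\<tau> \<in> bv_ball X \<AA> (\<Sum>P\<in>?A. \<bar>c P\<bar>)"
    unfolding bv_ball_iff[OF alg]
  proof (intro conjI allI impI)
    show "additive \<AA> \<tau>"
      unfolding additive_def
    proof (intro ballI impI)
      fix A B assume "A \<in> \<AA>" "B \<in> \<AA>" "A \<inter> B = {}"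
      then have "(indicator (u P) (A \<union> B) :: real) = indicator (u P) A + indicator (u P) B"
        if "P \<in> ?A" for P
        using ultrafilter_additive[OF alg U[OF that]] unfolding additive_def by blast
      then show "\<tau> (A \<union> B) = \<tau> A + \<tau> B"
        by (simp add: \<tau>_def sum.distrib[symmetric] distrib_left)
    qed
    fix \<P> assume P: "finite \<P> \<and> \<P> \<subseteq> \<AA> \<and> partition_on X \<P>"
    have "(\<Sum>Q\<in>\<P>. \<bar>\<tau> Q\<bar>) \<le> (\<Sum>Q\<in>\<P>. \<Sum>P\<in>?A. \<bar>c P\<bar> * indicator (u P) Q)"
      unfolding \<tau>_def by (intro sum_mono order_trans[OF sum_abs]) (simp add: abs_mult)
    also have "\<dots> = (\<Sum>P\<in>?A. \<bar>c P\<bar> * (\<Sum>Q\<in>\<P>. indicator (u P) Q))"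
      by (subst sum.swap) (simp add: sum_distrib_left)
    also have "\<dots> \<le> (\<Sum>P\<in>?A. \<bar>c P\<bar> * 1)"
      using P U by (intro sum_mono mult_left_mono ultrafilter_sum_partition_le) (auto simp: partition_on_def)
    finally show "(\<Sum>Q\<in>\<P>. \<bar>\<tau> Q\<bar>) \<le> (\<Sum>P\<in>?A. \<bar>c P\<bar>)" by simp
  qed
  moreover have "\<tau> A \<in> \<rat>" for A
    unfolding \<tau>_def using c by (intro Rats_sum Rats_mult) (auto simp: indicator_def)
  ultimately have 2: "\<tau> \<in> rat_bv_ball X \<AA> (\<Sum>P\<in>?A. \<bar>c P\<bar>)" by (simp add: rat_bv_ball_def)
  have 3: "\<tau> Q = c Q" if Q: "Q \<in> ?A" for Q
  proof -
    have "Q \<notin> u P" if P: "P \<in> ?A" "P \<noteq> Q" for P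
    proof
      assume "Q \<in> u P"
      then have "P \<inter> Q \<in> u P" using u[OF P(1)] U[OF P(1)] by (auto simp: ultrafilters_of_def)
      moreover have "P \<inter> Q = {}" using pA P Q by (auto simp: partition_on_def disjoint_def)
      ultimately show False using U[OF P(1)] by (auto simp: ultrafilters_of_def)
    qed
    then have "\<tau> Q = (\<Sum>P\<in>?A. if P = Q then c P else 0)"
      unfolding \<tau>_def using u Q by (intro sum.cong) (auto simp: indicator_def)
    then show ?thesis using Q fA by simp
  qed
  show ?thesis using that 1 2 3 by blast
qed

text \<open>
  Density of \<open>S\<close> thus replaces extension of a measure from \<open>\<BB>\<close> to \<open>\<AA>\<close> by choice from a countable set, with no
  loss in norm.
\<close>

lemma rational_measure_extension:
  assumes alg: "algebra X \<AA>" and sub: "finite_subalgebra X \<AA> \<BB>"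
    and S: "S \<subseteq> ultrafilters_of X \<AA>" "\<And>A. A \<in> \<AA> \<Longrightarrow> A \<noteq> {} \<Longrightarrow> \<exists>U\<in>S. A \<in> U"
    and \<nu>: "additive \<BB> \<nu>" "\<And>B. B \<in> \<BB> \<Longrightarrow> \<nu> B \<in> \<rat>" "(\<Sum>P\<in>atoms X \<BB>. \<bar>\<nu> P\<bar>) \<le> s"
  obtains \<tau> where "\<tau> \<in> rational_point_measures S" "\<tau> \<in> rat_bv_ball X \<AA> s"
    and "\<And>B. B \<in> \<BB> \<Longrightarrow> \<tau> B = \<nu> B"
proof -
  have B: "finite \<BB>" "algebra X \<BB>" "\<BB> \<subseteq> \<AA>" using sub by (auto simp: finite_subalgebra_def)
  have "\<nu> P \<in> \<rat>" if "P \<in> atoms X \<BB>" for P using that atoms_subset[OF B(1,2)] \<nu>(2) by blast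
  then obtain \<tau> where t: "\<tau> \<in> rational_point_measures S"
    "\<tau> \<in> rat_bv_ball X \<AA> (\<Sum>P\<in>atoms X \<BB>. \<bar>\<nu> P\<bar>)"
    "\<And>P. P \<in> atoms X \<BB> \<Longrightarrow> \<tau> P = \<nu> P"
    using point_measure_with_given_atoms[OF alg sub S, of \<nu>] by metis
  have s: "\<tau> \<in> rat_bv_ball X \<AA> s"
    using t(2) \<nu>(3) bv_ball_mono[OF alg] by (auto simp: rat_bv_ball_def)
  have a: "additive \<BB> \<tau>"
    using s additive_subset[OF _ B(3)] by (auto simp: rat_bv_ball_def bv_ball_iff[OF alg])
  show ?thesis
    using that[OF t(1) s measure_eq_if_eq_on_atoms[OF B(1,2) a \<nu>(1) t(3)]] by blast
qed

lemma rational_below: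
  fixes x \<eta> :: real
  assumes "\<eta> > 0"
  shows "\<exists>q\<in>\<rat>. \<bar>q\<bar> \<le> \<bar>x\<bar> \<and> \<bar>q - x\<bar> \<le> \<eta>"
proof (cases "x = 0")
  case True
  then show ?thesis using assms by (intro bexI[of _ 0]) auto
next
  case False
  show ?thesis
  proof (cases "x > 0")
    case True
    then obtain q where "q \<in> \<rat>" "max 0 (x - \<eta>) < q" "q < x"
      using Rats_dense_in_real[of "max 0 (x - \<eta>)" x] assms by auto
    then show ?thesis by (intro bexI[of _ q]) auto
  next
    case F: False
    then obtain q where "q \<in> \<rat>" "x < q" "q < min 0 (x + \<eta>)"
      using Rats_dense_in_real[of x "min 0 (x + \<eta>)"] assms False by auto
    then show ?thesis by (intro bexI[of _ q]) auto
  qed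
qed

text \<open>
  The masses of the atoms are rounded towards zero, so that the norm does not grow.
\<close>

lemma rational_approximation:
  assumes alg: "algebra X \<AA>" and sub: "finite_subalgebra X \<AA> \<BB>"
    and S: "S \<subseteq> ultrafilters_of X \<AA>" "\<And>A. A \<in> \<AA> \<Longrightarrow> A \<noteq> {} \<Longrightarrow> \<exists>U\<in>S. A \<in> U"
    and \<mu>: "\<mu> \<in> bv_ball X \<AA> s" and \<delta>: "\<delta> > 0"
  obtains \<tau> where "\<tau> \<in> rational_point_measures S" "\<tau> \<in> rat_bv_ball X \<AA> s"
    and "\<And>B. B \<in> \<BB> \<Longrightarrow> \<bar>\<tau> B - \<mu> B\<bar> \<le> \<delta>"
proof -
  let ?A = "atoms X \<BB>"
  have B: "finite \<BB>" "algebra X \<BB>" "\<BB> \<subseteq> \<AA>" using sub by (auto simp: finite_subalgebra_def)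
  note fA = finite_atoms[OF B(1,2)]
  define \<eta> where "\<eta> = \<delta> / (real (card ?A) + 1)"
  have \<eta>: "\<eta> > 0" using \<delta> by (simp add: \<eta>_def add_nonneg_pos)
  have "\<forall>P. \<exists>q. q \<in> \<rat> \<and> \<bar>q\<bar> \<le> \<bar>\<mu> P\<bar> \<and> \<bar>q - \<mu> P\<bar> \<le> \<eta>"
    using rational_below[OF \<eta>] by blast
  then obtain c where c: "\<And>P. c P \<in> \<rat>" "\<And>P. \<bar>c P\<bar> \<le> \<bar>\<mu> P\<bar>" "\<And>P. \<bar>c P - \<mu> P\<bar> \<le> \<eta>"
    using choice[of "\<lambda>P q. q \<in> \<rat> \<and> \<bar>q\<bar> \<le> \<bar>\<mu> P\<bar> \<and> \<bar>q - \<mu> P\<bar> \<le> \<eta>"] by blast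
  obtain \<tau> where t: "\<tau> \<in> rational_point_measures S"
    "\<tau> \<in> rat_bv_ball X \<AA> (\<Sum>P\<in>?A. \<bar>c P\<bar>)" "\<And>P. P \<in> ?A \<Longrightarrow> \<tau> P = c P"
    by (rule point_measure_with_given_atoms[OF alg sub S, of c]) (use c(1) in auto)
  have m: "\<mu> \<in> bv_ball X \<BB> s" using bv_ball_subalgebra[OF alg B(2,3) \<mu>] .
  have "(\<Sum>P\<in>?A. \<bar>c P\<bar>) \<le> (\<Sum>P\<in>?A. \<bar>\<mu> P\<bar>)" using c by (intro sum_mono) auto
  also have "\<dots> \<le> s" using sum_atoms_le_of_bv_ball[OF B(1,2) m] .
  finally have s: "\<tau> \<in> rat_bv_ball X \<AA> s"
    using t(2) bv_ball_mono[OF alg] by (auto simp: rat_bv_ball_def)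
  have a: "additive \<BB> \<tau>" "additive \<BB> \<mu>"
    using s m additive_subset[OF _ B(3)] by (auto simp: rat_bv_ball_def bv_ball_iff[OF alg] bv_ball_iff[OF B(2)])
  have "\<bar>\<tau> B' - \<mu> B'\<bar> \<le> \<delta>" if "B' \<in> \<BB>" for B'
  proof -
    let ?D = "{P \<in> ?A. P \<subseteq> B'}"
    have "\<bar>\<tau> B' - \<mu> B'\<bar> = \<bar>\<Sum>P\<in>?D. \<tau> P - \<mu> P\<bar>"
      by (simp add: measure_eq_sum_atoms[OF B(1,2) a(1) that] measure_eq_sum_atoms[OF B(1,2) a(2) that]
          sum_subtractf)
    also have "\<dots> \<le> (\<Sum>P\<in>?D. \<eta>)"
      using c t(3) by (intro order_trans[OF sum_abs] sum_mono) auto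
    also have "\<dots> = card ?D * \<eta>" by simp
    also have "\<dots> \<le> (real (card ?A) + 1) * \<eta>"
      using \<eta> card_mono[OF fA, of ?D] by (intro mult_right_mono) auto
    also have "\<dots> = \<delta>" by (simp add: \<eta>_def)
    finally show ?thesis .
  qed
  then show ?thesis using that t(1) s by blast
qed

text \<open>
  Each nonempty \<open>A\<close> defines a nonempty open set of ultrafilters, since it belongs to the principal
  ultrafilter of any of its points.
\<close>

lemma separable_stone_space_dense:
  assumes alg: "algebra X \<AA>" and sep: "separable_space (stone_space X \<AA>)"
  obtains S where "countable S" "S \<subseteq> ultrafilters_of X \<AA>"
    "\<And>A. A \<in> \<AA> \<Longrightarrow> A \<noteq> {} \<Longrightarrow> \<exists>U\<in>S. A \<in> U"
proof -
  obtain S where S: "countable S" "S \<subseteq> ultrafilters_of X \<AA>"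
    "stone_space X \<AA> closure_of S = ultrafilters_of X \<AA>"
    using sep topspace_stone_space[OF alg] by (auto simp: separable_space_def)
  have "\<exists>U\<in>S. A \<in> U" if A: "A \<in> \<AA>" "A \<noteq> {}" for A
  proof -
    obtain x where x: "x \<in> A" using A by auto
    let ?U = "{B \<in> \<AA>. x \<in> B}"
    have "?U \<in> ultrafilters_of X \<AA>"
      using alg A x by (auto simp: ultrafilters_of_def algebra_iff_Int intro: algebra.top[OF alg])
    moreover have "openin (stone_space X \<AA>) {U \<in> ultrafilters_of X \<AA>. A \<in> U}"
      using A unfolding stone_space_def by (intro topology_generated_by_Basis) auto
    ultimately show ?thesis
      using S(3) A x unfolding in_closure_of set_eq_iff by (smt (verit) mem_Collect_eq)
  qed
  then show ?thesis using that S by blast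
qed

section \<open>Posets and cardinals\<close>

text \<open>
  Martin's axiom is assumed for posets on one type \<open>'p\<close>. An injection copies any poset that fits into
  \<open>'p\<close>, and directed sets are pulled back along it.
\<close>

lemma martins_axiom_transfer:
  fixes \<kappa> :: "'k rel" and f :: "'q \<Rightarrow> 'p" and P :: "'q set"
  assumes MA: "martins_axiom TYPE('p) \<kappa>" and f: "inj_on f P"
    and P: "P \<noteq> {}" "partial_order_on P le" "ccc P le"
    and D: "\<And>\<xi>. \<xi> \<in> Field \<kappa> \<Longrightarrow> dense_in P le (D \<xi>)"
  shows "\<exists>G. directed_in P le G \<and> (\<forall>\<xi>\<in>Field \<kappa>. G \<inter> D \<xi> \<noteq> {})"
proof -
  define L where "L = map_prod f f ` le"
  have sub: "le \<subseteq> P \<times> P" and refl: "refl_on P le" and trans: "trans le" and anti: "antisym le"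
    using P(2) by (auto simp: partial_order_on_def preorder_on_def)
  have L_E: "\<exists>p q. (p, q) \<in> le \<and> x = f p \<and> y = f q" if "(x, y) \<in> L" for x y
    using that by (auto simp: L_def)
  have L_I: "(f p, f q) \<in> L" if "(p, q) \<in> le" for p q
    using that by (force simp: L_def)
  have le_iff: "(f p, f q) \<in> L \<longleftrightarrow> (p, q) \<in> le" if "p \<in> P" "q \<in> P" for p q
  proof
    assume "(f p, f q) \<in> L"
    then obtain p' q' where *: "(p', q') \<in> le" "f p = f p'" "f q = f q'" using L_E by blast
    then have "p' \<in> P" "q' \<in> P" using sub by auto
    then have "p = p'" "q = q'" using * that f by (auto simp: inj_on_def)
    then show "(p, q) \<in> le" using * by simp
  qed (rule L_I)
  have "refl_on (f ` P) L" using refl L_I by (auto simp: refl_on_def)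
  moreover have L_sub: "L \<subseteq> f ` P \<times> f ` P" using sub by (auto simp: L_def)
  moreover have "trans L"
  proof (rule transI)
    fix x y z assume "(x, y) \<in> L" "(y, z) \<in> L"
    then obtain p q q' s where *: "(p, q) \<in> le" "(q', s) \<in> le" "x = f p" "y = f q" "y = f q'" "z = f s"
      using L_E by metis
    then have "q = q'" using f sub by (auto simp: inj_on_def)
    then have "(p, s) \<in> le" using * trans by (auto dest: transD)
    then show "(x, z) \<in> L" using * L_I by simp
  qed
  moreover have "antisym L"
  proof (rule antisymI)
    fix x y assume xy: "(x, y) \<in> L" "(y, x) \<in> L"
    then obtain p q where *: "(p, q) \<in> le" "x = f p" "y = f q" using L_E by blast
    then have "(q, p) \<in> le" using le_iff[of q p] xy sub by auto
    then show "x = y" using * anti by (auto dest: antisymD)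
  qed
  ultimately have po: "partial_order_on (f ` P) L"
    by (simp add: partial_order_on_def preorder_on_def)
  have ccc: "ccc (f ` P) L"
    unfolding ccc_def
  proof (intro allI impI)
    fix Q assume Q: "Q \<subseteq> f ` P" "uncountable Q"
    then obtain R where R: "R \<subseteq> P" "Q = f ` R" by (auto simp: subset_image_iff)
    then have "uncountable R" using Q by auto
    then have "\<exists>p\<in>R. \<exists>q\<in>R. p \<noteq> q \<and> (\<exists>s\<in>P. (p, s) \<in> le \<and> (q, s) \<in> le)"
      using P(3) R(1) unfolding ccc_def by simp
    then obtain p q s where pq: "p \<in> R" "q \<in> R" "p \<noteq> q" "s \<in> P" "(p, s) \<in> le" "(q, s) \<in> le"
      by (elim bexE conjE)
    then have "f p \<in> Q" "f q \<in> Q" "f p \<noteq> f q" "f s \<in> f ` P" "(f p, f s) \<in> L" "(f q, f s) \<in> L"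
      using R f L_I inj_onD[OF f, of p q] by auto
    then show "\<exists>p\<^sub>1\<in>Q. \<exists>p\<^sub>2\<in>Q. p\<^sub>1 \<noteq> p\<^sub>2 \<and> (\<exists>q\<in>f ` P. (p\<^sub>1, q) \<in> L \<and> (p\<^sub>2, q) \<in> L)"
      by blast
  qed
  have dense: "dense_in (f ` P) L (f ` D \<xi>)" if "\<xi> \<in> Field \<kappa>" for \<xi>
    using D[OF that] L_I unfolding dense_in_def by blast
  have "\<exists>G. directed_in (f ` P) L G \<and> (\<forall>\<xi>\<in>Field \<kappa>. G \<inter> f ` D \<xi> \<noteq> {})"
    using MA[unfolded martins_axiom_def, rule_format, of "f ` P" L "\<lambda>\<xi>. f ` D \<xi>"] P(1) po ccc dense
    by blast
  then obtain G' where G': "directed_in (f ` P) L G'"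
    "\<And>\<xi>. \<xi> \<in> Field \<kappa> \<Longrightarrow> G' \<inter> f ` D \<xi> \<noteq> {}"
    by blast
  define G where "G = {p \<in> P. f p \<in> G'}"
  have "directed_in P le G"
    unfolding directed_in_def
  proof (intro conjI ballI)
    show "G \<subseteq> P" by (auto simp: G_def)
    fix p q assume "p \<in> G" "q \<in> G"
    then have pq: "p \<in> P" "q \<in> P" "f p \<in> G'" "f q \<in> G'" by (auto simp: G_def)
    obtain t where t: "t \<in> G'" "(f p, t) \<in> L" "(f q, t) \<in> L"
      using G'(1)[unfolded directed_in_def, THEN conjunct2, rule_format, OF pq(3,4)] by blast
    obtain s where s: "s \<in> P" "t = f s" using t(2) L_sub by auto
    have "(p, s) \<in> le" "(q, s) \<in> le" using pq t s le_iff by auto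
    moreover have "s \<in> G" using s t by (simp add: G_def)
    ultimately show "\<exists>s\<in>G. (p, s) \<in> le \<and> (q, s) \<in> le" by blast
  qed
  moreover have "G \<inter> D \<xi> \<noteq> {}" if "\<xi> \<in> Field \<kappa>" for \<xi>
    using G'(2)[OF that] D[OF that] by (auto simp: G_def dense_in_def)
  ultimately show ?thesis by blast
qed

lemma card_of_finite_subsets:
  assumes "infinite A"
  shows "|{F. finite F \<and> F \<subseteq> A}| \<le>o |A|"
proof -
  let ?S = "\<lambda>n. {F. finite F \<and> F \<subseteq> A \<and> card F = n}"
  have "|?S n| \<le>o |A|" for n
  proof (induction n)
    case 0
    have "?S 0 = {{}}" by auto
    then show ?case using assms by (simp add: card_of_singl_ordLeq infinite_imp_nonempty)
  next
    case (Suc n)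
    have "?S (Suc n) \<subseteq> (\<lambda>(a, F). insert a F) ` (A \<times> ?S n)"
    proof
      fix F assume F: "F \<in> ?S (Suc n)"
      then obtain a G where "F = insert a G" "a \<notin> G" "card G = n" by (auto simp: card_Suc_eq)
      then show "F \<in> (\<lambda>(a, F). insert a F) ` (A \<times> ?S n)" using F by (intro image_eqI[of _ _ "(a, G)"]) auto
    qed
    then have "|?S (Suc n)| \<le>o |A \<times> ?S n|"
      by (rule ordLeq_transitive[OF card_of_mono1 card_of_image])
    moreover have "|A \<times> ?S n| \<le>o |A|"
      using Suc assms by (intro card_of_Sigma_ordLeq_infinite ballI card_of_refl[THEN ordIso_imp_ordLeq])
    ultimately show ?case using ordLeq_transitive by blast
  qed
  then have "|\<Union>n. ?S n| \<le>o |A|"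
    using assms infinite_iff_card_of_nat by (intro card_of_UNION_ordLeq_infinite) auto
  moreover have "(\<Union>n. ?S n) = {F. finite F \<and> F \<subseteq> A}" by auto
  ultimately show ?thesis by simp
qed

lemma card_of_countable_ordLeq:
  assumes "countable C" "infinite A"
  shows "|C| \<le>o |A|"
proof -
  obtain f :: "_ \<Rightarrow> nat" where "inj_on f C" using assms(1) by (auto simp: countable_def)
  then have "|C| \<le>o |UNIV :: nat set|" by (auto simp flip: card_of_ordLeq)
  then show ?thesis using assms(2) infinite_iff_card_of_nat ordLeq_transitive by blast
qed

section \<open>Approximating on two subalgebras at once\<close>

lemma zero_mem_bv_ball: "algebra X \<AA> \<Longrightarrow> 0 \<le> s \<Longrightarrow> (\<lambda>_. 0) \<in> bv_ball X \<AA> s"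
  by (auto simp: bv_ball_iff additive_def)

lemma dist_on_upper:
  assumes "finite \<BB>" "B \<in> \<BB>"
  shows "\<bar>\<mu> B - \<psi> B\<bar> \<le> dist_on \<BB> \<mu> \<psi>"
  unfolding dist_on_def using assms by (intro cSUP_upper bdd_above_finite) auto

lemma dist_on_nonneg:
  assumes "finite \<BB>" "algebra X \<BB>"
  shows "0 \<le> dist_on \<BB> \<mu> \<psi>"
  using dist_on_upper[OF assms(1) algebra.top[OF assms(2)], of \<mu> \<psi>] by linarith

lemma INF_dist_less_obtain:
  assumes "algebra X \<AA>" "finite_subalgebra X \<AA> \<BB>"
    and "(INF \<mu>\<in>bv_ball X \<AA> 1. dist_on \<BB> \<mu> \<psi>) < \<epsilon>"
  obtains \<mu> where "\<mu> \<in> bv_ball X \<AA> 1" "\<And>B. B \<in> \<BB> \<Longrightarrow> \<bar>\<mu> B - \<psi> B\<bar> < \<epsilon>"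
proof -
  have B: "finite \<BB>" "algebra X \<BB>" using assms(2) by (auto simp: finite_subalgebra_def)
  have "bdd_below ((\<lambda>\<mu>. dist_on \<BB> \<mu> \<psi>) ` bv_ball X \<AA> 1)"
    using dist_on_nonneg[OF B] by (intro bdd_belowI2[of _ 0]) auto
  moreover have "bv_ball X \<AA> 1 \<noteq> {}" using zero_mem_bv_ball[OF assms(1), of 1] by auto
  ultimately obtain \<mu> where m: "\<mu> \<in> bv_ball X \<AA> 1" "dist_on \<BB> \<mu> \<psi> < \<epsilon>"
    using assms(3) by (subst (asm) cINF_less_iff) auto
  then have "\<bar>\<mu> B' - \<psi> B'\<bar> < \<epsilon>" if "B' \<in> \<BB>" for B'
    using dist_on_upper[OF B(1) that, of \<mu> \<psi>] by linarith
  then show ?thesis using that m by blast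
qed

text \<open>
  The property that LEP provides for some pair of members of each uncountable part of the witnessing
  family.
\<close>

definition commonly_extendable :: "'a set \<Rightarrow> real \<Rightarrow> 'a set set \<Rightarrow> 'a set set \<Rightarrow> bool" where
  "commonly_extendable X r \<BB>\<^sub>1 \<BB>\<^sub>2 \<longleftrightarrow>
     (\<forall>\<nu>\<^sub>1\<in>rat_bv_ball X \<BB>\<^sub>1 1. \<forall>\<nu>\<^sub>2\<in>rat_bv_ball X \<BB>\<^sub>2 1.
        (\<forall>B\<in>\<BB>\<^sub>1 \<inter> \<BB>\<^sub>2. \<nu>\<^sub>1 B = \<nu>\<^sub>2 B) \<longrightarrow>
        (\<exists>\<nu>\<in>rat_bv_ball X (algebra X hull (\<BB>\<^sub>1 \<union> \<BB>\<^sub>2)) r.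
           (\<forall>B\<in>\<BB>\<^sub>1. \<nu> B = \<nu>\<^sub>1 B) \<and> (\<forall>B\<in>\<BB>\<^sub>2. \<nu> B = \<nu>\<^sub>2 B)))"

lemma rat_bv_ball_subalgebra:
  assumes "algebra X \<AA>" "algebra X \<BB>" "\<BB> \<subseteq> \<AA>" "\<mu> \<in> rat_bv_ball X \<AA> s"
  shows "\<mu> \<in> rat_bv_ball X \<BB> s"
  using assms bv_ball_subalgebra[OF assms(1-3)] by (auto simp: rat_bv_ball_def)

text \<open>
  The difference \<open>\<sigma>\<close> of \<open>\<tau>\<^sub>1\<close> and \<open>\<tau>\<^sub>2\<close> is at most \<open>2 * \<epsilon>\<close> on \<open>\<BB>\<^sub>1 \<inter> \<BB>\<^sub>2\<close>, hence has norm at most \<open>4 * \<epsilon>\<close> there, and it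
  extends to a measure \<open>\<sigma>'\<close> on \<open>\<AA>\<close> with that norm. Then \<open>\<tau>\<^sub>1\<close> and \<open>\<tau>\<^sub>2 + \<sigma>'\<close> are consistent and have norm at most
  \<open>1 + 4 * \<epsilon>\<close>. Rescaling them into the unit ball costs \<open>4 * \<epsilon>\<close>, so on \<open>\<BB>\<^sub>2\<close> the error is at most
  \<open>\<epsilon> + 4 * \<epsilon> + 4 * \<epsilon>\<close>, and on \<open>\<BB>\<^sub>1\<close>, where no correction is made, at most \<open>\<epsilon> + 4 * \<epsilon>\<close>. The number \<open>\<epsilon>\<close> has to be rational because the rescaled measures must
  be rational-valued.
\<close>

lemma common_approximation:
  assumes alg: "algebra X \<AA>"
    and sub: "finite_subalgebra X \<AA> \<BB>\<^sub>1" "finite_subalgebra X \<AA> \<BB>\<^sub>2"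
    and S: "S \<subseteq> ultrafilters_of X \<AA>" "\<And>A. A \<in> \<AA> \<Longrightarrow> A \<noteq> {} \<Longrightarrow> \<exists>U\<in>S. A \<in> U"
    and ext: "commonly_extendable X r \<BB>\<^sub>1 \<BB>\<^sub>2"
    and \<epsilon>: "\<epsilon> \<in> \<rat>" "0 \<le> \<epsilon>"
    and \<tau>\<^sub>1: "\<tau>\<^sub>1 \<in> rat_bv_ball X \<AA> 1" "\<And>B. B \<in> \<BB>\<^sub>1 \<Longrightarrow> \<bar>\<tau>\<^sub>1 B - \<psi> B\<bar> \<le> \<epsilon>"
    and \<tau>\<^sub>2: "\<tau>\<^sub>2 \<in> rat_bv_ball X \<AA> 1" "\<And>B. B \<in> \<BB>\<^sub>2 \<Longrightarrow> \<bar>\<tau>\<^sub>2 B - \<psi> B\<bar> \<le> \<epsilon>"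
  obtains \<nu> where "\<nu> \<in> rational_point_measures S" "\<nu> \<in> bv_ball X \<AA> r"
    and "\<And>B. B \<in> \<BB>\<^sub>1 \<union> \<BB>\<^sub>2 \<Longrightarrow> \<bar>\<nu> B - \<psi> B\<bar> \<le> 9 * \<epsilon>"
proof -
  let ?R = "\<BB>\<^sub>1 \<inter> \<BB>\<^sub>2" and ?H = "algebra X hull (\<BB>\<^sub>1 \<union> \<BB>\<^sub>2)"
  have B1: "finite \<BB>\<^sub>1" "algebra X \<BB>\<^sub>1" "\<BB>\<^sub>1 \<subseteq> \<AA>" and B2: "finite \<BB>\<^sub>2" "algebra X \<BB>\<^sub>2" "\<BB>\<^sub>2 \<subseteq> \<AA>"
    using sub by (auto simp: finite_subalgebra_def)
  have R: "finite_subalgebra X \<AA> ?R" "finite ?R" "algebra X ?R"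
    using B1 B2 algebra_inter by (auto simp: finite_subalgebra_def)
  have H: "finite_subalgebra X \<AA> ?H" using finite_subalgebra_hull[OF alg] B1 B2 by simp
  have t1: "\<tau>\<^sub>1 \<in> bv_ball X \<AA> 1" "\<And>A. A \<in> \<AA> \<Longrightarrow> \<tau>\<^sub>1 A \<in> \<rat>"
    and t2: "\<tau>\<^sub>2 \<in> bv_ball X \<AA> 1" "\<And>A. A \<in> \<AA> \<Longrightarrow> \<tau>\<^sub>2 A \<in> \<rat>"
    using \<tau>\<^sub>1 \<tau>\<^sub>2 by (auto simp: rat_bv_ball_def)
  define \<sigma> where "\<sigma> A = \<tau>\<^sub>1 A - \<tau>\<^sub>2 A" for A
  have "additive \<AA> \<sigma>"
    using t1(1) t2(1) unfolding bv_ball_iff[OF alg] additive_def \<sigma>_def by simp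
  then have \<sigma>: "additive ?R \<sigma>" using B1 by (auto intro: additive_subset)
  have \<sigma>_rat: "\<sigma> B \<in> \<rat>" if "B \<in> ?R" for B
    unfolding \<sigma>_def using that B1(3) t1(2) t2(2) by (intro Rats_diff) auto
  have "\<bar>\<sigma> B\<bar> \<le> 2 * \<epsilon>" if "B \<in> ?R" for B
    using \<tau>\<^sub>1(2)[of B] \<tau>\<^sub>2(2)[of B] that by (simp add: \<sigma>_def)
  then have "(\<Sum>P\<in>atoms X ?R. \<bar>\<sigma> P\<bar>) \<le> 2 * (2 * \<epsilon>)"
    by (intro sum_atoms_le_sup[OF R(2,3) \<sigma>]) auto
  then have "(\<Sum>P\<in>atoms X ?R. \<bar>\<sigma> P\<bar>) \<le> 4 * \<epsilon>" by simp
  then obtain \<sigma>' where s': "\<sigma>' \<in> rat_bv_ball X \<AA> (4 * \<epsilon>)" "\<And>B. B \<in> ?R \<Longrightarrow> \<sigma>' B = \<sigma> B"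
    using rational_measure_extension[OF alg R(1) S \<sigma> \<sigma>_rat] by blast
  then have s'_ball: "\<sigma>' \<in> bv_ball X \<AA> (4 * \<epsilon>)" and s'_rat: "\<And>A. A \<in> \<AA> \<Longrightarrow> \<sigma>' A \<in> \<rat>"
    by (auto simp: rat_bv_ball_def)
  define c where "c = 1 / (1 + 4 * \<epsilon>)"
  have c: "c \<in> \<rat>" "0 \<le> c" "c \<le> 1" "c * (1 + 4 * \<epsilon>) = 1"
    using \<epsilon> by (auto simp: c_def intro!: Rats_divide Rats_add Rats_mult)
  define \<nu>\<^sub>1 where "\<nu>\<^sub>1 A = c * \<tau>\<^sub>1 A" for A
  define \<nu>\<^sub>2 where "\<nu>\<^sub>2 A = c * (\<tau>\<^sub>2 A + \<sigma>' A)" for A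
  have "\<nu>\<^sub>1 \<in> bv_ball X \<AA> 1"
    using bv_ball_mono[OF alg bv_ball_scale[OF alg t1(1), of c]] c unfolding \<nu>\<^sub>1_def by simp
  moreover have "\<nu>\<^sub>2 \<in> bv_ball X \<AA> 1"
    using bv_ball_scale[OF alg bv_ball_add[OF alg t2(1) s'_ball], of c] c unfolding \<nu>\<^sub>2_def by simp
  ultimately have \<nu>: "\<nu>\<^sub>1 \<in> rat_bv_ball X \<AA> 1" "\<nu>\<^sub>2 \<in> rat_bv_ball X \<AA> 1"
    using c(1) t1(2) t2(2) s'_rat by (auto simp: rat_bv_ball_def \<nu>\<^sub>1_def \<nu>\<^sub>2_def)
  have "\<nu>\<^sub>1 B = \<nu>\<^sub>2 B" if "B \<in> ?R" for B
    using s'(2)[OF that] by (simp add: \<nu>\<^sub>1_def \<nu>\<^sub>2_def \<sigma>_def)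
  then obtain \<nu> where n: "\<nu> \<in> rat_bv_ball X ?H r"
    "\<And>B. B \<in> \<BB>\<^sub>1 \<Longrightarrow> \<nu> B = \<nu>\<^sub>1 B" "\<And>B. B \<in> \<BB>\<^sub>2 \<Longrightarrow> \<nu> B = \<nu>\<^sub>2 B"
    using ext rat_bv_ball_subalgebra[OF alg B1(2,3) \<nu>(1)] rat_bv_ball_subalgebra[OF alg B2(2,3) \<nu>(2)]
    unfolding commonly_extendable_def by blast
  have H': "finite ?H" "algebra X ?H" using H by (auto simp: finite_subalgebra_def)
  have nH: "additive ?H \<nu>" "\<And>B. B \<in> ?H \<Longrightarrow> \<nu> B \<in> \<rat>" "(\<Sum>P\<in>atoms X ?H. \<bar>\<nu> P\<bar>) \<le> r"
    using n(1) sum_atoms_le_of_bv_ball[OF H'] by (auto simp: rat_bv_ball_def bv_ball_iff[OF H'(2)])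
  obtain \<rho> where \<rho>: "\<rho> \<in> rational_point_measures S" "\<rho> \<in> rat_bv_ball X \<AA> r"
    "\<And>B. B \<in> ?H \<Longrightarrow> \<rho> B = \<nu> B"
    using rational_measure_extension[OF alg H S nH] by blast
  have scale: "\<bar>c * x - x\<bar> \<le> 4 * \<epsilon>" if "\<bar>x\<bar> \<le> 1 + 4 * \<epsilon>" for x
  proof -
    have "\<bar>c * x - x\<bar> = (1 - c) * \<bar>x\<bar>"
    proof -
      have "c * x - x = - ((1 - c) * x)" by (simp add: algebra_simps)
      then show ?thesis using c(3) by (simp add: abs_mult)
    qed
    also have "\<dots> \<le> (1 - c) * (1 + 4 * \<epsilon>)" using that c(3) by (intro mult_left_mono) auto
    also have "\<dots> = 4 * \<epsilon>" using c(4) by (simp add: algebra_simps)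
    finally show ?thesis .
  qed
  have "\<bar>\<rho> B - \<psi> B\<bar> \<le> 9 * \<epsilon>" if "B \<in> \<BB>\<^sub>1" for B
  proof -
    have "\<bar>\<tau>\<^sub>1 B\<bar> \<le> 1" using abs_le_of_bv_ball[OF alg t1(1)] that B1(3) by blast
    then have "\<bar>c * \<tau>\<^sub>1 B - \<tau>\<^sub>1 B\<bar> \<le> 4 * \<epsilon>" using \<epsilon>(2) by (intro scale) auto
    moreover have "\<rho> B = c * \<tau>\<^sub>1 B" using that \<rho>(3) n(2) by (simp add: hull_inc \<nu>\<^sub>1_def)
    ultimately show ?thesis using \<tau>\<^sub>1(2)[OF that] \<epsilon>(2) by linarith
  qed
  moreover have "\<bar>\<rho> B - \<psi> B\<bar> \<le> 9 * \<epsilon>" if "B \<in> \<BB>\<^sub>2" for B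
  proof -
    have "\<bar>\<tau>\<^sub>2 B\<bar> \<le> 1" "\<bar>\<sigma>' B\<bar> \<le> 4 * \<epsilon>"
      using abs_le_of_bv_ball[OF alg t2(1)] abs_le_of_bv_ball[OF alg s'_ball] that B2(3) by blast+
    then have "\<bar>c * (\<tau>\<^sub>2 B + \<sigma>' B) - (\<tau>\<^sub>2 B + \<sigma>' B)\<bar> \<le> 4 * \<epsilon>" "\<bar>\<sigma>' B\<bar> \<le> 4 * \<epsilon>"
      by (auto intro!: scale)
    moreover have "\<rho> B = c * (\<tau>\<^sub>2 B + \<sigma>' B)" using that \<rho>(3) n(3) by (simp add: hull_inc \<nu>\<^sub>2_def)
    ultimately show ?thesis using \<tau>\<^sub>2(2)[OF that] \<epsilon>(2) by linarith
  qed
  moreover have "\<rho> \<in> bv_ball X \<AA> r" using \<rho>(2) by (simp add: rat_bv_ball_def)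
  ultimately show ?thesis using that \<rho>(1) by blast
qed

section \<open>The forcing poset\<close>

text \<open>
  \<open>\<B>\<close> is a family of finite subalgebras that witnesses LEP, \<open>S\<close> a countable dense set of ultrafilters, and
  \<open>\<phi>\<close> a sequence of functions to which the approximation property is to be applied.
\<close>

locale approximation_forcing =
  fixes X :: "'a set" and \<AA> :: "'a set set" and r :: real
    and \<B> :: "'a set set set" and S :: "'a set set set" and \<phi> :: "nat \<Rightarrow> 'a set \<Rightarrow> real"
  assumes alg: "algebra X \<AA>" and r: "1 < r"
    and family: "\<And>\<BB>. \<BB> \<in> \<B> \<Longrightarrow> finite_subalgebra X \<AA> \<BB>"
    and cofinal: "\<And>\<CC>. finite_subalgebra X \<AA> \<CC> \<Longrightarrow> \<exists>\<BB>\<in>\<B>. \<CC> \<subseteq> \<BB>"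
    and extendable_pair: "\<And>\<B>'. \<B>' \<subseteq> \<B> \<Longrightarrow> uncountable \<B>' \<Longrightarrow>
      \<exists>\<BB>\<^sub>1\<in>\<B>'. \<exists>\<BB>\<^sub>2\<in>\<B>'. \<BB>\<^sub>1 \<noteq> \<BB>\<^sub>2 \<and> commonly_extendable X r \<BB>\<^sub>1 \<BB>\<^sub>2"
    and S: "countable S" "S \<subseteq> ultrafilters_of X \<AA>"
    and S_dense: "\<And>A. A \<in> \<AA> \<Longrightarrow> A \<noteq> {} \<Longrightarrow> \<exists>U\<in>S. A \<in> U"
    and approx: "\<And>\<BB>. finite_subalgebra X \<AA> \<BB> \<Longrightarrow>
      (\<lambda>n. INF \<mu>\<in>bv_ball X \<AA> 1. dist_on \<BB> \<mu> (\<phi> n)) \<longlonglongrightarrow> 0"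
begin

definition pool :: "('a set \<Rightarrow> real) set" where
  "pool = rational_point_measures S \<inter> bv_ball X \<AA> r"

definition well_approximable :: "'a set set \<Rightarrow> nat \<Rightarrow> real \<Rightarrow> bool" where
  "well_approximable \<BB> k \<epsilon> \<longleftrightarrow>
     (\<exists>\<tau>\<in>rational_point_measures S. \<tau> \<in> rat_bv_ball X \<AA> 1 \<and> (\<forall>B\<in>\<BB>. \<bar>\<tau> B - \<phi> k B\<bar> \<le> \<epsilon>))"

definition tolerance :: "nat \<Rightarrow> real" where
  "tolerance m = 1 / (real m + 1)"

text \<open>
  The factor 9 is the loss in \<open>common_approximation\<close>. The measures in \<open>l\<close> are not compared with
  \<open>\<phi>\<close>: a condition restricts only indices from \<open>length l\<close> on.
\<close>

definition conditions :: "('a set set \<times> nat \<times> ('a set \<Rightarrow> real) list) set" where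
  "conditions = {(\<BB>, m, l). \<BB> \<in> \<B> \<and> l \<in> lists pool \<and>
     (\<forall>k\<ge>length l. well_approximable \<BB> k (tolerance m / 9))}"

definition extends :: "('a set set \<times> nat \<times> ('a set \<Rightarrow> real) list) rel" where
  "extends = {((\<BB>, m, l), (\<BB>', m', l')).
     (\<BB>, m, l) \<in> conditions \<and> (\<BB>', m', l') \<in> conditions \<and> \<BB> \<subseteq> \<BB>' \<and> m \<le> m' \<and>
     length l \<le> length l' \<and> (\<forall>k<length l. l' ! k = l ! k) \<and>
     (\<forall>k. length l \<le> k \<and> k < length l' \<longrightarrow> (\<forall>B\<in>\<BB>. \<bar>(l' ! k) B - \<phi> k B\<bar> \<le> tolerance m))}"

lemma tolerance_pos: "0 < tolerance m"
  by (simp add: tolerance_def add_nonneg_pos)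

lemma tolerance_antimono: "m \<le> m' \<Longrightarrow> tolerance m' \<le> tolerance m"
  by (simp add: tolerance_def frac_le)

lemma tolerance_Rats: "tolerance m \<in> \<rat>"
  by (auto simp: tolerance_def intro!: Rats_divide Rats_add)

lemma countable_pool: "countable pool"
  unfolding pool_def using countable_rational_point_measures[OF S(1)] by (rule countable_Int1)

lemma eventually_well_approximable:
  assumes B: "finite_subalgebra X \<AA> \<BB>" and "0 < \<epsilon>"
  obtains N where "\<And>k. N \<le> k \<Longrightarrow> well_approximable \<BB> k \<epsilon>"
proof -
  have "eventually (\<lambda>n. (INF \<mu>\<in>bv_ball X \<AA> 1. dist_on \<BB> \<mu> (\<phi> n)) < \<epsilon> / 2) sequentially"
    using order_tendstoD(2)[OF approx[OF B], of "\<epsilon> / 2"] assms(2) by simp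
  then obtain N where N: "\<And>k. N \<le> k \<Longrightarrow> (INF \<mu>\<in>bv_ball X \<AA> 1. dist_on \<BB> \<mu> (\<phi> k)) < \<epsilon> / 2"
    by (auto simp: eventually_sequentially)
  have "well_approximable \<BB> k \<epsilon>" if k: "N \<le> k" for k
  proof -
    obtain \<mu> where m: "\<mu> \<in> bv_ball X \<AA> 1" "\<And>B. B \<in> \<BB> \<Longrightarrow> \<bar>\<mu> B - \<phi> k B\<bar> < \<epsilon> / 2"
      using INF_dist_less_obtain[OF alg B N[OF k]] by blast
    obtain \<tau> where t: "\<tau> \<in> rational_point_measures S" "\<tau> \<in> rat_bv_ball X \<AA> 1"
      "\<And>B. B \<in> \<BB> \<Longrightarrow> \<bar>\<tau> B - \<mu> B\<bar> \<le> \<epsilon> / 2"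
      by (rule rational_approximation[OF alg B S(2) S_dense m(1), of "\<epsilon> / 2"]) (use assms(2) in auto)
    have "\<bar>\<tau> B - \<phi> k B\<bar> \<le> \<epsilon>" if "B \<in> \<BB>" for B using m(2)[OF that] t(3)[OF that] by linarith
    then show ?thesis unfolding well_approximable_def using t(1,2) by blast
  qed
  then show ?thesis using that by blast
qed

text \<open>
  Transitivity: an index added in the second step obeys the promise of the middle condition, which is
  at least as strong as that of the first.
\<close>

lemma partial_order_extends: "partial_order_on conditions extends"
  unfolding partial_order_on_def preorder_on_def
proof (intro conjI)
  show "extends \<subseteq> conditions \<times> conditions" by (auto simp: extends_def)
  show "refl_on conditions extends" by (auto simp: refl_on_def extends_def)
  show "trans extends"
  proof (rule transI)
    fix p q s assume pq: "(p, q) \<in> extends" and qs: "(q, s) \<in> extends"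
    obtain \<BB>\<^sub>1 m\<^sub>1 l\<^sub>1 \<BB>\<^sub>2 m\<^sub>2 l\<^sub>2 \<BB>\<^sub>3 m\<^sub>3 l\<^sub>3
      where e: "p = (\<BB>\<^sub>1, m\<^sub>1, l\<^sub>1)" "q = (\<BB>\<^sub>2, m\<^sub>2, l\<^sub>2)" "s = (\<BB>\<^sub>3, m\<^sub>3, l\<^sub>3)"
      by (cases p, cases q, cases s) auto
    note pq' = pq[unfolded e extends_def mem_Collect_eq prod.case]
      and qs' = qs[unfolded e extends_def mem_Collect_eq prod.case]
    have "\<bar>(l\<^sub>3 ! k) B - \<phi> k B\<bar> \<le> tolerance m\<^sub>1"
      if k: "length l\<^sub>1 \<le> k" "k < length l\<^sub>3" and B: "B \<in> \<BB>\<^sub>1" for k B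
    proof (cases "k < length l\<^sub>2")
      case True
      then show ?thesis using pq' qs' k B by simp
    next
      case False
      have "\<bar>(l\<^sub>3 ! k) B - \<phi> k B\<bar> \<le> tolerance m\<^sub>2" using False pq' qs' k B by auto
      also have "\<dots> \<le> tolerance m\<^sub>1" using pq' by (intro tolerance_antimono) simp
      finally show ?thesis .
    qed
    then show "(p, s) \<in> extends"
      using pq' qs' unfolding e extends_def by auto
  qed
  show "antisym extends"
    by (rule antisymI) (auto simp: extends_def intro!: nth_equalityI)
qed

text \<open>
  Passing to a larger subalgebra \<open>\<BB>'\<close> or a higher precision \<open>m'\<close> is credible only from some index \<open>N\<close> on, so the
  list must first be continued up to \<open>N\<close>. The continuation \<open>v\<close> keeps the promises of every condition with
  list \<open>l\<close> that it approximates well, possibly of several conditions simultaneously: with one condition this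
  gives density, with two it gives compatibility.
\<close>

lemma amalgamate:
  assumes l: "l \<in> lists pool" and v: "\<And>k. length l \<le> k \<Longrightarrow> v k \<in> pool"
    and D: "finite_subalgebra X \<AA> \<D>"
  obtains \<BB>' l' where "\<D> \<subseteq> \<BB>'" "n \<le> length l'" "(\<BB>', m', l') \<in> conditions"
    and "\<And>\<BB> m. (\<BB>, m, l) \<in> conditions \<Longrightarrow> \<BB> \<subseteq> \<D> \<Longrightarrow> m \<le> m' \<Longrightarrow>
      (\<And>k B. length l \<le> k \<Longrightarrow> B \<in> \<BB> \<Longrightarrow> \<bar>v k B - \<phi> k B\<bar> \<le> tolerance m) \<Longrightarrow>
      ((\<BB>, m, l), (\<BB>', m', l')) \<in> extends"
proof -
  obtain \<BB>' where B': "\<BB>' \<in> \<B>" "\<D> \<subseteq> \<BB>'" using cofinal[OF D] by blast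
  obtain N where N: "\<And>k. N \<le> k \<Longrightarrow> well_approximable \<BB>' k (tolerance m' / 9)"
    using eventually_well_approximable[OF family[OF B'(1)], of "tolerance m' / 9"] tolerance_pos
    by (auto simp: tolerance_pos)
  define l' where "l' = map (\<lambda>k. if k < length l then l ! k else v k) [0..<Max {N, n, length l}]"
  have len: "N \<le> length l'" "n \<le> length l'" "length l \<le> length l'"
    by (auto simp: l'_def)
  have old: "l' ! k = l ! k" if "k < length l" for k
    using that len(3) unfolding l'_def by auto
  have new: "l' ! k = v k" if "length l \<le> k" "k < length l'" for k
    using that unfolding l'_def by auto
  have "l' \<in> lists pool"
    using l v by (auto simp: l'_def in_lists_conv_set)
  then have cond: "(\<BB>', m', l') \<in> conditions"
    using B'(1) N len(1) by (simp add: conditions_def)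
  show ?thesis
  proof (rule that[OF B'(2) len(2) cond])
    fix \<BB> m
    assume "(\<BB>, m, l) \<in> conditions" "\<BB> \<subseteq> \<D>" "m \<le> m'"
      "\<And>k B. length l \<le> k \<Longrightarrow> B \<in> \<BB> \<Longrightarrow> \<bar>v k B - \<phi> k B\<bar> \<le> tolerance m"
    then show "((\<BB>, m, l), (\<BB>', m', l')) \<in> extends"
      using cond B'(2) len(3) old new unfolding extends_def by auto
  qed
qed

lemma rat_unit_ball_pool:
  assumes "\<tau> \<in> rational_point_measures S" "\<tau> \<in> rat_bv_ball X \<AA> 1"
  shows "\<tau> \<in> pool"
  using assms bv_ball_mono[OF alg, of \<tau> 1 r] r by (simp add: pool_def rat_bv_ball_def)

lemma conditions_nonempty: "conditions \<noteq> {}"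
proof -
  have "finite_subalgebra X \<AA> {{}, X}"
    using alg algebra.top[OF alg] by (auto simp: finite_subalgebra_def algebra_iff_Un)
  moreover obtain N where "well_approximable {{}, X} N 1"
    using eventually_well_approximable[OF calculation, of 1] by auto
  then obtain \<tau> where "\<tau> \<in> pool"
    using rat_unit_ball_pool by (auto simp: well_approximable_def)
  ultimately show ?thesis
    using amalgamate[where l = "[]" and v = "\<lambda>_. \<tau>" and \<D> = "{{}, X}"]
    by (metis emptyE lists.Nil)
qed

text \<open>
  Credibility supplies the continuation: measures of norm at most 1 that satisfy the promise on \<open>\<BB>\<close>.
\<close>

lemma extend_condition:
  assumes p: "(\<BB>, m, l) \<in> conditions" and C: "finite_subalgebra X \<AA> \<CC>"
  obtains \<BB>' m' l' where "((\<BB>, m, l), (\<BB>', m', l')) \<in> extends"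
    "\<CC> \<subseteq> \<BB>'" "n \<le> m'" "n \<le> length l'"
proof -
  have B: "finite_subalgebra X \<AA> \<BB>" and l: "l \<in> lists pool"
    and w: "\<And>k. length l \<le> k \<Longrightarrow> well_approximable \<BB> k (tolerance m / 9)"
    using p family by (auto simp: conditions_def)
  have "\<exists>\<tau>. \<tau> \<in> pool \<and> (\<forall>B\<in>\<BB>. \<bar>\<tau> B - \<phi> k B\<bar> \<le> tolerance m)" if k: "length l \<le> k" for k
  proof -
    obtain \<tau> where t: "\<tau> \<in> pool" "\<And>B. B \<in> \<BB> \<Longrightarrow> \<bar>\<tau> B - \<phi> k B\<bar> \<le> tolerance m / 9"
      using w[OF k] rat_unit_ball_pool unfolding well_approximable_def by blast
    have "tolerance m / 9 \<le> tolerance m" using tolerance_pos[of m] by simp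
    then show ?thesis using t order_trans by blast
  qed
  then obtain v where v: "\<And>k. length l \<le> k \<Longrightarrow> v k \<in> pool"
    "\<And>k B. length l \<le> k \<Longrightarrow> B \<in> \<BB> \<Longrightarrow> \<bar>v k B - \<phi> k B\<bar> \<le> tolerance m"
    by metis
  have H: "finite_subalgebra X \<AA> (algebra X hull (\<BB> \<union> \<CC>))"
    using B C by (intro finite_subalgebra_hull[OF alg]) (auto simp: finite_subalgebra_def)
  have sub: "\<BB> \<union> \<CC> \<subseteq> algebra X hull (\<BB> \<union> \<CC>)" by (rule hull_subset)
  show ?thesis
  proof (rule amalgamate[where l = l and v = v and \<D> = "algebra X hull (\<BB> \<union> \<CC>)"
        and n = n and m' = "max m n"])
    fix \<BB>' l'
    assume "algebra X hull (\<BB> \<union> \<CC>) \<subseteq> \<BB>'" "n \<le> length l'"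
      and *: "\<And>\<BB>\<^sub>0 m'. (\<BB>\<^sub>0, m', l) \<in> conditions \<Longrightarrow> \<BB>\<^sub>0 \<subseteq> algebra X hull (\<BB> \<union> \<CC>) \<Longrightarrow> m' \<le> max m n \<Longrightarrow>
        (\<And>k B. length l \<le> k \<Longrightarrow> B \<in> \<BB>\<^sub>0 \<Longrightarrow> \<bar>v k B - \<phi> k B\<bar> \<le> tolerance m') \<Longrightarrow>
        ((\<BB>\<^sub>0, m', l), (\<BB>', max m n, l')) \<in> extends"
    have "((\<BB>, m, l), (\<BB>', max m n, l')) \<in> extends"
      using sub v(2) by (intro *[OF p]) auto
    then show ?thesis
      using that[of \<BB>' "max m n" l'] \<open>_ \<subseteq> \<BB>'\<close> \<open>n \<le> length l'\<close> sub by auto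
  qed (use l v H in auto)
qed

text \<open>
  Here the continuation has to keep two promises, which is what \<open>common_approximation\<close> is for. Its
  ninefold loss turns the credible accuracy into the promised one.
\<close>

lemma compatible_conditions:
  assumes p: "(\<BB>\<^sub>1, m, l) \<in> conditions" "(\<BB>\<^sub>2, m, l) \<in> conditions"
    and ext: "commonly_extendable X r \<BB>\<^sub>1 \<BB>\<^sub>2"
  shows "\<exists>q\<in>conditions. ((\<BB>\<^sub>1, m, l), q) \<in> extends \<and> ((\<BB>\<^sub>2, m, l), q) \<in> extends"
proof -
  have B: "finite_subalgebra X \<AA> \<BB>\<^sub>1" "finite_subalgebra X \<AA> \<BB>\<^sub>2" and l: "l \<in> lists pool"
    and w: "\<And>k. length l \<le> k \<Longrightarrow> well_approximable \<BB>\<^sub>1 k (tolerance m / 9)"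
      "\<And>k. length l \<le> k \<Longrightarrow> well_approximable \<BB>\<^sub>2 k (tolerance m / 9)"
    using p family by (auto simp: conditions_def)
  have e: "tolerance m / 9 \<in> \<rat>" "0 \<le> tolerance m / 9"
    using tolerance_Rats tolerance_pos[of m] by (auto intro!: Rats_divide)
  have "\<exists>\<tau>. \<tau> \<in> pool \<and> (\<forall>B\<in>\<BB>\<^sub>1 \<union> \<BB>\<^sub>2. \<bar>\<tau> B - \<phi> k B\<bar> \<le> tolerance m)" if k: "length l \<le> k" for k
  proof -
    obtain \<tau>\<^sub>1 where t1: "\<tau>\<^sub>1 \<in> rat_bv_ball X \<AA> 1" "\<And>B. B \<in> \<BB>\<^sub>1 \<Longrightarrow> \<bar>\<tau>\<^sub>1 B - \<phi> k B\<bar> \<le> tolerance m / 9"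
      using w(1)[OF k] unfolding well_approximable_def by blast
    obtain \<tau>\<^sub>2 where t2: "\<tau>\<^sub>2 \<in> rat_bv_ball X \<AA> 1" "\<And>B. B \<in> \<BB>\<^sub>2 \<Longrightarrow> \<bar>\<tau>\<^sub>2 B - \<phi> k B\<bar> \<le> tolerance m / 9"
      using w(2)[OF k] unfolding well_approximable_def by blast
    obtain \<nu> where "\<nu> \<in> rational_point_measures S" "\<nu> \<in> bv_ball X \<AA> r"
      "\<And>B. B \<in> \<BB>\<^sub>1 \<union> \<BB>\<^sub>2 \<Longrightarrow> \<bar>\<nu> B - \<phi> k B\<bar> \<le> 9 * (tolerance m / 9)"
      using common_approximation[OF alg B S(2) S_dense ext e t1 t2] by blast
    then show ?thesis by (auto simp: pool_def)
  qed
  then obtain v where v: "\<And>k. length l \<le> k \<Longrightarrow> v k \<in> pool"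
    "\<And>k B. length l \<le> k \<Longrightarrow> B \<in> \<BB>\<^sub>1 \<union> \<BB>\<^sub>2 \<Longrightarrow> \<bar>v k B - \<phi> k B\<bar> \<le> tolerance m"
    by metis
  let ?H = "algebra X hull (\<BB>\<^sub>1 \<union> \<BB>\<^sub>2)"
  have H: "finite_subalgebra X \<AA> ?H"
    using B by (intro finite_subalgebra_hull[OF alg]) (auto simp: finite_subalgebra_def)
  have sub: "\<BB>\<^sub>1 \<union> \<BB>\<^sub>2 \<subseteq> ?H" by (rule hull_subset)
  show ?thesis
  proof (rule amalgamate[where l = l and v = v and \<D> = ?H and n = 0 and m' = m])
    fix \<BB>' l'
    assume cond: "(\<BB>', m, l') \<in> conditions"
      and *: "\<And>\<BB> m'. (\<BB>, m', l) \<in> conditions \<Longrightarrow> \<BB> \<subseteq> ?H \<Longrightarrow> m' \<le> m \<Longrightarrow>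
        (\<And>k B. length l \<le> k \<Longrightarrow> B \<in> \<BB> \<Longrightarrow> \<bar>v k B - \<phi> k B\<bar> \<le> tolerance m') \<Longrightarrow>
        ((\<BB>, m', l), (\<BB>', m, l')) \<in> extends"
    have "((\<BB>\<^sub>1, m, l), (\<BB>', m, l')) \<in> extends" using sub v(2) by (intro *[OF p(1)]) auto
    moreover have "((\<BB>\<^sub>2, m, l), (\<BB>', m, l')) \<in> extends" using sub v(2) by (intro *[OF p(2)]) auto
    ultimately show ?thesis using cond by blast
  qed (use l v H in auto)
qed

text \<open>
  Conditions with the same precision and list are distinguished by their subalgebras, so an uncountable
  set of them gives an uncountable part of \<open>\<B>\<close>, as LEP requires.
\<close>

lemma ccc_conditions: "ccc conditions extends"
  unfolding ccc_def
proof (intro allI impI)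
  fix Q assume Q: "Q \<subseteq> conditions" "uncountable Q"
  let ?T = "(UNIV :: nat set) \<times> lists pool"
  let ?F = "\<lambda>t. {p \<in> Q. snd p = t}"
  have "countable ?T" using countable_pool by blast
  moreover have "Q = (\<Union>t\<in>?T. ?F t)" using Q(1) by (auto simp: conditions_def)
  ultimately obtain t where t: "uncountable (?F t)"
    using Q(2) countable_UN[of ?T ?F] by metis
  have "inj_on fst (?F t)" by (auto simp: inj_on_def)
  then have "uncountable (fst ` ?F t)" using t countable_image_inj_on by blast
  moreover have "fst ` ?F t \<subseteq> \<B>" using Q(1) by (auto simp: conditions_def)
  ultimately have "\<exists>\<BB>\<^sub>1\<in>fst ` ?F t. \<exists>\<BB>\<^sub>2\<in>fst ` ?F t. \<BB>\<^sub>1 \<noteq> \<BB>\<^sub>2 \<and> commonly_extendable X r \<BB>\<^sub>1 \<BB>\<^sub>2"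
    by (intro extendable_pair)
  then obtain \<BB>\<^sub>1 \<BB>\<^sub>2 where B: "\<BB>\<^sub>1 \<in> fst ` ?F t" "\<BB>\<^sub>2 \<in> fst ` ?F t" "\<BB>\<^sub>1 \<noteq> \<BB>\<^sub>2"
    "commonly_extendable X r \<BB>\<^sub>1 \<BB>\<^sub>2"
    by (elim bexE conjE)
  obtain m l where ml: "t = (m, l)" by (cases t)
  have mem: "(\<BB>\<^sub>1, m, l) \<in> Q" "(\<BB>\<^sub>2, m, l) \<in> Q" using B(1,2) ml by auto
  then have "\<exists>q\<in>conditions. ((\<BB>\<^sub>1, m, l), q) \<in> extends \<and> ((\<BB>\<^sub>2, m, l), q) \<in> extends"
    using Q(1) by (intro compatible_conditions[OF _ _ B(4)]) auto
  then show "\<exists>p\<^sub>1\<in>Q. \<exists>p\<^sub>2\<in>Q. p\<^sub>1 \<noteq> p\<^sub>2 \<and> (\<exists>q\<in>conditions. (p\<^sub>1, q) \<in> extends \<and> (p\<^sub>2, q) \<in> extends)"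
    using mem B(3) by blast
qed

definition deciding :: "'a set \<Rightarrow> nat \<Rightarrow> ('a set set \<times> nat \<times> ('a set \<Rightarrow> real) list) set" where
  "deciding a n = {(\<BB>, m, l) \<in> conditions. a \<in> \<BB> \<and> n \<le> m \<and> n \<le> length l}"

lemma dense_deciding:
  assumes "a \<in> \<AA>"
  shows "dense_in conditions extends (deciding a n)"
  unfolding dense_in_def
proof (intro conjI ballI)
  show "deciding a n \<subseteq> conditions" by (auto simp: deciding_def)
  fix p assume p: "p \<in> conditions"
  obtain \<BB> m l where e: "p = (\<BB>, m, l)" by (cases p)
  have a: "a \<in> algebra X hull {a}" by (simp add: hull_inc)
  have "finite_subalgebra X \<AA> (algebra X hull {a})"
    using assms by (intro finite_subalgebra_hull[OF alg]) auto
  then obtain \<BB>' m' l' where *: "((\<BB>, m, l), (\<BB>', m', l')) \<in> extends"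
    "algebra X hull {a} \<subseteq> \<BB>'" "n \<le> m'" "n \<le> length l'"
    using extend_condition[OF p[unfolded e]] by blast
  then have "(\<BB>', m', l') \<in> deciding a n" using a by (auto simp: deciding_def extends_def)
  then show "\<exists>d\<in>deciding a n. (p, d) \<in> extends" using * e by blast
qed

lemma card_of_conditions:
  assumes "infinite \<AA>"
  shows "|conditions| \<le>o |\<AA>|"
proof -
  let ?F = "{\<BB>. finite \<BB> \<and> \<BB> \<subseteq> \<AA>}" and ?T = "(UNIV :: nat set) \<times> lists pool"
  have "conditions \<subseteq> ?F \<times> ?T"
    using family by (auto simp: conditions_def finite_subalgebra_def)
  then have "|conditions| \<le>o |?F \<times> ?T|" by (rule card_of_mono1)
  moreover have "|?F \<times> ?T| \<le>o |\<AA>|"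
    using assms countable_pool card_of_finite_subsets card_of_countable_ordLeq[of ?T \<AA>]
    by (intro card_of_Sigma_ordLeq_infinite) blast+
  ultimately show ?thesis using ordLeq_transitive by blast
qed

text \<open>
  Directedness makes the lists of the conditions in \<open>G\<close> initial segments of one sequence \<open>\<nu>\<close>, and it
  transfers the promise of each condition in \<open>G\<close> to all later entries of \<open>\<nu>\<close>.
\<close>

lemma measures_of_generic:
  assumes G: "directed_in conditions extends G"
    and meets: "\<And>a n. a \<in> \<AA> \<Longrightarrow> G \<inter> deciding a n \<noteq> {}"
  shows "\<exists>\<nu>. (\<forall>n. \<nu> n \<in> bv_ball X \<AA> r) \<and> (\<forall>a\<in>\<AA>. (\<lambda>n. \<phi> n a - \<nu> n a) \<longlonglongrightarrow> 0)"
proof -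
  have Gsub: "G \<subseteq> conditions" using G by (simp add: directed_in_def)
  have "\<exists>p\<in>G. k < length (snd (snd p))" for k
    using meets[OF algebra.top[OF alg], of "Suc k"] by (fastforce simp: deciding_def)
  then obtain p where p: "\<And>k. p k \<in> G" "\<And>k. k < length (snd (snd (p k)))" by metis
  define \<nu> where "\<nu> k = snd (snd (p k)) ! k" for k
  have "\<nu> k \<in> pool" for k
  proof -
    have "snd (snd (p k)) \<in> lists pool" using p(1)[of k] Gsub by (auto simp: conditions_def)
    then show ?thesis using p(2)[of k] by (auto simp: \<nu>_def in_lists_conv_set)
  qed
  then have ball: "\<nu> k \<in> bv_ball X \<AA> r" for k by (auto simp: pool_def)
  have coherent: "\<bar>\<nu> k B - \<phi> k B\<bar> \<le> tolerance m"
    if q: "(\<BB>, m, l) \<in> G" and k: "length l \<le> k" and B: "B \<in> \<BB>" for \<BB> m l k B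
  proof -
    obtain s where s: "((\<BB>, m, l), s) \<in> extends" "(p k, s) \<in> extends"
      using G q p(1)[of k] unfolding directed_in_def by blast
    obtain \<BB>' m' l' where e: "s = (\<BB>', m', l')" by (cases s)
    have "k < length l'" "l' ! k = \<nu> k"
      using s(2) p(2)[of k] unfolding e \<nu>_def extends_def by auto
    then show ?thesis using s(1) k B unfolding e extends_def by auto
  qed
  have "(\<lambda>n. \<phi> n a - \<nu> n a) \<longlonglongrightarrow> 0" if a: "a \<in> \<AA>" for a
  proof (rule LIMSEQ_I)
    fix \<epsilon> :: real assume "0 < \<epsilon>"
    then obtain n where n: "inverse (real (Suc n)) < \<epsilon>" using reals_Archimedean by blast
    obtain \<BB> m l where q: "(\<BB>, m, l) \<in> G" "a \<in> \<BB>" "n \<le> m"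
      using meets[OF a, of n] by (auto simp: deciding_def)
    have "tolerance m \<le> tolerance n" using q(3) by (rule tolerance_antimono)
    also have "tolerance n < \<epsilon>" using n by (simp add: tolerance_def inverse_eq_divide add.commute)
    finally have "norm (\<phi> k a - \<nu> k a - 0) < \<epsilon>" if "length l \<le> k" for k
      using coherent[OF q(1) that q(2)] by (simp add: abs_minus_commute)
    then show "\<exists>n0. \<forall>n\<ge>n0. norm (\<phi> n a - \<nu> n a - 0) < \<epsilon>" by blast
  qed
  then show ?thesis using ball by blast
qed

end

section \<open>The approximation property\<close>

text \<open>
  Here \<open>\<AA>\<close> is a finite subalgebra of itself, so near-optimal measures for the distance on \<open>\<AA>\<close> do the job.
  The infimum need not be attained, hence the extra \<open>1 / (n + 1)\<close>.
\<close>

lemma approximation_property_finite: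
  assumes alg: "algebra X \<AA>" and fin: "finite \<AA>"
  shows "approximation_property X \<AA>"
  unfolding approximation_property_def
proof (intro allI impI)
  fix \<phi> :: "nat \<Rightarrow> 'a set \<Rightarrow> real"
  assume "(\<forall>n. \<forall>a\<in>\<AA>. \<phi> n a \<in> {-1..1}) \<and>
    (\<forall>\<BB>. finite_subalgebra X \<AA> \<BB> \<longrightarrow> (\<lambda>n. INF \<mu>\<in>bv_ball X \<AA> 1. dist_on \<BB> \<mu> (\<phi> n)) \<longlonglongrightarrow> 0)"
  moreover have sub: "finite_subalgebra X \<AA> \<AA>" using alg fin by (simp add: finite_subalgebra_def)
  ultimately have lim: "(\<lambda>n. INF \<mu>\<in>bv_ball X \<AA> 1. dist_on \<AA> \<mu> (\<phi> n)) \<longlonglongrightarrow> 0" by blast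
  let ?e = "\<lambda>n. (INF \<mu>\<in>bv_ball X \<AA> 1. dist_on \<AA> \<mu> (\<phi> n)) + 1 / real (Suc n)"
  have "\<exists>\<mu>\<in>bv_ball X \<AA> 1. \<forall>a\<in>\<AA>. \<bar>\<mu> a - \<phi> n a\<bar> < ?e n" for n
    by (rule INF_dist_less_obtain[OF alg sub, of "\<phi> n" "?e n"]) auto
  then obtain \<nu> where \<nu>: "\<And>n. \<nu> n \<in> bv_ball X \<AA> 1" "\<And>n a. a \<in> \<AA> \<Longrightarrow> \<bar>\<nu> n a - \<phi> n a\<bar> < ?e n"
    by metis
  have "?e \<longlonglongrightarrow> 0 + 0"
    by (intro tendsto_add lim LIMSEQ_Suc[OF lim_1_over_n])
  then have null: "?e \<longlonglongrightarrow> 0" by (simp only: add_0)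
  have "(\<lambda>n. \<phi> n a - \<nu> n a) \<longlonglongrightarrow> 0" if "a \<in> \<AA>" for a
  proof (rule Lim_null_comparison[OF _ null])
    have "norm (\<phi> n a - \<nu> n a) \<le> ?e n" for n
      unfolding real_norm_def using \<nu>(2)[OF that, of n] by linarith
    then show "\<forall>\<^sub>F n in sequentially. norm (\<phi> n a - \<nu> n a) \<le> ?e n" by (intro always_eventually allI)
  qed
  then show "\<exists>\<nu>. (\<exists>r. \<forall>n. \<nu> n \<in> bv_ball X \<AA> r) \<and> (\<forall>a\<in>\<AA>. (\<lambda>n. \<phi> n a - \<nu> n a) \<longlonglongrightarrow> 0)"
    using \<nu>(1) by blast
qed

theorem theorem4p8:
  fixes X :: "'a set" and \<AA> :: "'a set set" and \<kappa> :: "'k rel" and r :: real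
  assumes "algebra X \<AA>"
    and "Card_order \<kappa>" and "|\<AA>| =o \<kappa>"
    and "r > 1" and "LEP X \<AA> r"
    and "separable_space (stone_space X \<AA>)"
    and "\<kappa> \<le>o |UNIV :: 'p set|" and "martins_axiom TYPE('p) \<kappa>"
  shows "approximation_property X \<AA>"
proof (cases "finite \<AA>")
  case True
  then show ?thesis using assms(1) by (rule approximation_property_finite[rotated])
next
  case False
  obtain \<B> where B: "\<And>\<BB>. \<BB> \<in> \<B> \<Longrightarrow> finite_subalgebra X \<AA> \<BB>"
    "\<And>\<CC>. finite_subalgebra X \<AA> \<CC> \<Longrightarrow> \<exists>\<BB>\<in>\<B>. \<CC> \<subseteq> \<BB>"
    "\<And>\<B>'. \<B>' \<subseteq> \<B> \<Longrightarrow> uncountable \<B>' \<Longrightarrow>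
      \<exists>\<BB>\<^sub>1\<in>\<B>'. \<exists>\<BB>\<^sub>2\<in>\<B>'. \<BB>\<^sub>1 \<noteq> \<BB>\<^sub>2 \<and> commonly_extendable X r \<BB>\<^sub>1 \<BB>\<^sub>2"
    using assms(5) unfolding LEP_def commonly_extendable_def[symmetric] by metis
  obtain S where S: "countable S" "S \<subseteq> ultrafilters_of X \<AA>"
    "\<And>A. A \<in> \<AA> \<Longrightarrow> A \<noteq> {} \<Longrightarrow> \<exists>U\<in>S. A \<in> U"
    using separable_stone_space_dense[OF assms(1,6)] by blast
  have "|\<AA>| =o |Field \<kappa>|"
    using assms(2,3) card_of_Field_ordIso ordIso_symmetric ordIso_transitive by blast
  then obtain h where "bij_betw h (Field \<kappa>) \<AA>"
    using card_of_ordIso ordIso_symmetric by blast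
  then have h: "h ` Field \<kappa> = \<AA>" by (simp add: bij_betw_def)
  \<comment> \<open>The dense sets \<open>deciding a n\<close> are indexed by pairs. Only those with \<open>n = inv e a\<close> are met directly, one
    for each \<open>a\<close>: \<open>inv e\<close> takes every value \<open>n\<close>, namely at \<open>e n\<close>, so a common extension of a condition
    that decides \<open>a\<close> and one that decides \<open>e n\<close> takes care of the pair \<open>(a, n)\<close>.\<close>
  obtain e :: "nat \<Rightarrow> 'a set" where e: "inj e" "range e \<subseteq> \<AA>"
    using False infinite_countable_subset by blast
  show ?thesis
    unfolding approximation_property_def
  proof (intro allI impI)
    fix \<phi> :: "nat \<Rightarrow> 'a set \<Rightarrow> real"
    assume \<phi>: "(\<forall>n. \<forall>a\<in>\<AA>. \<phi> n a \<in> {-1..1}) \<and>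
      (\<forall>\<BB>. finite_subalgebra X \<AA> \<BB> \<longrightarrow> (\<lambda>n. INF \<mu>\<in>bv_ball X \<AA> 1. dist_on \<BB> \<mu> (\<phi> n)) \<longlonglongrightarrow> 0)"
    interpret approximation_forcing X \<AA> r \<B> S \<phi>
      by (rule approximation_forcing.intro)
        (assumption | rule assms(1) assms(4) B S \<phi>[THEN conjunct2, rule_format])+
    have "|conditions| \<le>o |UNIV :: 'p set|"
      using card_of_conditions[OF False] assms(3,7) ordLeq_ordIso_trans ordLeq_transitive by blast
    then obtain f :: "_ \<Rightarrow> 'p" where f: "inj_on f conditions"
      unfolding card_of_ordLeq[symmetric] by (elim exE conjE)
    have dense: "dense_in conditions extends (deciding (h \<xi>) (inv e (h \<xi>)))" if "\<xi> \<in> Field \<kappa>" for \<xi>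
      using that h by (intro dense_deciding) auto
    have "\<exists>G. directed_in conditions extends G \<and>
        (\<forall>\<xi>\<in>Field \<kappa>. G \<inter> deciding (h \<xi>) (inv e (h \<xi>)) \<noteq> {})"
      by (rule martins_axiom_transfer[OF assms(8) f conditions_nonempty partial_order_extends ccc_conditions])
        (rule dense)
    then obtain G where G: "directed_in conditions extends G"
      "\<forall>\<xi>\<in>Field \<kappa>. G \<inter> deciding (h \<xi>) (inv e (h \<xi>)) \<noteq> {}"
      by (elim exE conjE)
    have G': "G \<inter> deciding a (inv e a) \<noteq> {}" if a: "a \<in> \<AA>" for a
    proof -
      obtain \<xi> where "\<xi> \<in> Field \<kappa>" "a = h \<xi>" using a h by auto
      then show ?thesis using G(2) by simp
    qed
    have "G \<inter> deciding a n \<noteq> {}" if a: "a \<in> \<AA>" for a n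
    proof -
      have "e n \<in> \<AA>" "inv e (e n) = n" using e by auto
      then obtain p where p: "p \<in> G" "p \<in> deciding (e n) n" using G'[of "e n"] by auto
      obtain q where q: "q \<in> G" "q \<in> deciding a (inv e a)" using G'[OF a] by auto
      obtain s where s: "s \<in> G" "(p, s) \<in> extends" "(q, s) \<in> extends"
        using G(1) p(1) q(1) unfolding directed_in_def by blast
      then have "s \<in> deciding a n" using p(2) q(2) by (auto simp: deciding_def extends_def)
      then show ?thesis using s(1) by blast
    qed
    then show "\<exists>\<nu>. (\<exists>r. \<forall>n. \<nu> n \<in> bv_ball X \<AA> r) \<and> (\<forall>a\<in>\<AA>. (\<lambda>n. \<phi> n a - \<nu> n a) \<longlonglongrightarrow> 0)"
      using measures_of_generic[OF G(1)] by blast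
  qed
qed

end
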